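(* Let $n,d\ge 1$ and let $f_1,\dots,f_n:\mathbb{R}^d\to\mathbb{R}$ be twice differentiable functions with continuously differentiable gradients, for which there exist constants $\mu,L>0$ with $\mu I\preceq\nabla^2 f_i(x)\preceq L I$ for all $x\in\mathbb{R}^d$ and all $i\in\{1,\dots,n\}$ (so each $f_i$ is $\mu$-strongly convex with $L$-Lipschitz gradient). Assume moreover that for each $i$ the map $x\mapsto\nabla^2 f_i(x)^{-1}$ is continuously differentiable. Let $x^\star$ be the unique minimizer over $\mathbb{R}^d$ of $f(x)=\frac1n\sum_{i=1}^n f_i(x)$. Let $P\in\mathbb{R}^{n\times n}$ be a consensus matrix for a connected, time-invariant graph $\mathcal{G}=(\{1,\dots,n\},\mathcal{E})$ with bidirectional edges, as defined in the context. Then there exists a positive $\bar\epsilon$ such that for any step size $0<\epsilon\le\bar\epsilon$ the Network-GIANT algorithm (as defined in the context) converges semi-globally and exponentially fast to the exact solution $x^\star$. That is, for every $r>0$ there exists $\bar\epsilon>0$ such that for every $\epsilon\in(0,\bar\epsilon]$ there exist constants $C>0$ and $\gamma\in(0,1)$ such that, for every initialization $x_1^0,\dots,x_n^0\in\mathbb{R}^d$ with $\|x_i^0-x^\star\|\le r$ for all $i$, the iterates of Network-GIANT satisfy $$\|x_i^k-x^\star\|\le C\,\gamma^k\qquad\text{for all } k\ge 0 \text{ and all } i\in\{1,\dots,n\}.$$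
   Context: $\|\cdot\|$ is the Euclidean norm, $I$ is the identity matrix, and $\mathbb{1}$ is the all-ones vector (of dimension $n$ when multiplied by $P$). Consensus matrix. Let $\mathcal{G}=(\{1,\dots,n\},\mathcal{E})$ be a connected, time-invariant graph whose vertices are the agents and whose edges $\mathcal{E}$ are the available bidirectional communication links. A consensus matrix for $\mathcal{G}$ is a matrix $P=(p_{ij})\in\mathbb{R}^{n\times n}$ such that $p_{ij}>0$ if $(i,j)\in\mathcal{E}$ and $p_{ij}=0$ otherwise, $P$ is symmetric and doubly stochastic ($P\mathbb{1}=\mathbb{1}$, $\mathbb{1}^TP=\mathbb{1}^T$), and the null space of $I-P$ is $\mathrm{span}(\mathbb{1})$. Network-GIANT algorithm. Fix a step size $\epsilon>0$. Each agent $i\in\{1,\dots,n\}$ starts from an arbitrary $x_i^0\in\mathbb{R}^d$ and $w_i^0=0\in\mathbb{R}^d$, with the convention that the symbol $\nabla f_i(x_i^{-1})$ appearing at iteration $k=0$ denotes the zero vector (so $w_i^0=\nabla f_i(x_i^{-1})=0$). For $k=0,1,2,\dots$ and every $i\in\{1,\dots,n\}$: $$v_i^{k+1}=w_i^k+\nabla f_i(x_i^k)-\nabla f_i(x_i^{k-1}),\qquad w_i^{k+1}=\sum_{j=1}^n p_{ij}\,v_j^{k+1},$$ $$u_i^{k+1}=x_i^k-\epsilon\,\nabla^2 f_i(x_i^k)^{-1}w_i^{k+1},\qquad x_i^{k+1}=\sum_{j=1}^n p_{ij}\,u_j^{k+1}.$$ The iterates are thus determined by $(x_1^0,\dots,x_n^0)$,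 $P$, $\epsilon$ and the $f_i$.
   Formalization: It is additionally assumed that −1 is not an eigenvalue of P; without this the claim fails, e.g. for n=2, P=((0,1),(1,0)), f_1=f_2=x²/2, where the iterates from (c,−c) diverge for every step size. *)

theory Defs
  imports "HOL-Analysis.Analysis"
begin

definition gradient :: "('a::real_inner \<Rightarrow> real) \<Rightarrow> 'a \<Rightarrow> 'a" where
  "gradient f x = (THE D. GDERIV f x :> D)"

lemma gradient_eqI:
  assumes "GDERIV f x :> D"
  shows "gradient f x = D"
  unfolding gradient_def
proof (rule the_equality)
  fix D' assume "GDERIV f x :> D'"
  then have "(\<lambda>h. h \<bullet> D') = (\<lambda>h. h \<bullet> D)"
    using assms unfolding gderiv_def by (rule has_derivative_unique)
  then show "D' = D"
    by (metis vector_eq_ldot)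
qed (fact assms)

definition hessian :: "(real^'d \<Rightarrow> real) \<Rightarrow> real^'d \<Rightarrow> real^'d^'d" where
  "hessian f x = jacobian (gradient f) (at x)"

definition continuously_differentiable ::
  "('a::real_normed_vector \<Rightarrow> 'b::real_normed_vector) \<Rightarrow> bool" where
  "continuously_differentiable g \<longleftrightarrow>
     (\<exists>g' :: 'a \<Rightarrow> 'a \<Rightarrow>\<^sub>L 'b.
        (\<forall>x. (g has_derivative blinfun_apply (g' x)) (at x)) \<and> continuous_on UNIV g')"

definition pos_semidef :: "real^'m^'m \<Rightarrow> bool" where
  "pos_semidef A \<longleftrightarrow> transpose A = A \<and> (\<forall>v. 0 \<le> v \<bullet> (A *v v))"

definition loewner_le :: "real^'m^'m \<Rightarrow> real^'m^'m \<Rightarrow> bool"  (infix "\<preceq>\<^sub>L" 50) where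
  "A \<preceq>\<^sub>L B \<longleftrightarrow> pos_semidef (B - A)"

(* Bidirectional links are a symmetric edge relation. Loops (i, i) are neither required nor
   excluded: they record which agents put positive weight on their own value. *)
definition connected_graph :: "('n \<times> 'n) set \<Rightarrow> bool" where
  "connected_graph E \<longleftrightarrow> sym E \<and> E\<^sup>* = UNIV"

(* The vector 1 is the all-ones vector.
   These conditions do not exclude the eigenvalue -1 of P: it occurs (exactly) when E is
   bipartite, e.g. for two agents and P = ((0,1),(1,0)). *)
definition consensus_matrix :: "('n::finite \<times> 'n) set \<Rightarrow> real^'n^'n \<Rightarrow> bool" where
  "consensus_matrix E P \<longleftrightarrow>
     (\<forall>i j. if (i, j) \<in> E then P $ i $ j > 0 else P $ i $ j = 0) \<and>
     transpose P = P \<and> P *v 1 = 1 \<and> 1 v* P = 1 \<and>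
     {v. (mat 1 - P) *v v = 0} = span {1}"

(* The state after k iterations is (x^k, w^k, g^k), where g^k i is the previous local gradient,
   i.e. the gradient of f i at x^(k-1) i for k > 0, and 0 for k = 0. *)
primrec giant_state ::
  "('n::finite \<Rightarrow> real^'d \<Rightarrow> real) \<Rightarrow> real^'n^'n \<Rightarrow> real \<Rightarrow> ('n \<Rightarrow> real^'d) \<Rightarrow> nat \<Rightarrow>
     ('n \<Rightarrow> real^'d) \<times> ('n \<Rightarrow> real^'d) \<times> ('n \<Rightarrow> real^'d)" where
  "giant_state f P \<epsilon> x0 0 = (x0, \<lambda>i. 0, \<lambda>i. 0)"
| "giant_state f P \<epsilon> x0 (Suc k) =
     (let (x, w, g) = giant_state f P \<epsilon> x0 k;
          v = (\<lambda>i. w i + gradient (f i) (x i) - g i);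
          w' = (\<lambda>i. \<Sum>j\<in>UNIV. P $ i $ j *\<^sub>R v j);
          u = (\<lambda>i. x i - \<epsilon> *\<^sub>R (matrix_inv (hessian (f i) (x i)) *v w' i));
          x' = (\<lambda>i. \<Sum>j\<in>UNIV. P $ i $ j *\<^sub>R u j)
      in (x', w', \<lambda>i. gradient (f i) (x i)))"

definition network_giant ::
  "('n::finite \<Rightarrow> real^'d \<Rightarrow> real) \<Rightarrow> real^'n^'n \<Rightarrow> real \<Rightarrow> ('n \<Rightarrow> real^'d) \<Rightarrow> nat \<Rightarrow> 'n \<Rightarrow> real^'d"
  where
  "network_giant f P \<epsilon> x0 k = fst (giant_state f P \<epsilon> x0 k)"

end

theory Submission
  imports Defs
begin

text \<open>
  Along the iteration one follows three quantities: the optimality gap \<open>V\<close> of the mean position, the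
  disagreement \<open>b\<close> of the positions, and the disagreement \<open>c\<close> of the gradient trackers \<open>w\<close>. The
  trackers preserve the identity that their mean is the mean of the local gradients, hence equals the
  gradient \<open>G\<close> of the objective at the mean position up to an error of order \<open>b\<close>.

  The inverse Hessians are bounded and uniformly coercive. The mean position therefore takes a
  step of length \<open>\<epsilon>\<close> along a descent direction, perturbed by \<open>b\<close> and \<open>c\<close>, and by the descent lemma
  \<open>V\<close> decreases at rate \<open>\<epsilon> |G|\<^sup>2\<close> up to terms \<open>\<epsilon> |G| (b + c)\<close> and \<open>\<epsilon>\<^sup>2 (b + c + |G|)\<^sup>2\<close>. By strong
  monotonicity of the gradients, \<open>V\<close> is comparable to \<open>|G|\<^sup>2\<close>.

  On vectors of mean zero the consensus matrix is a strict contraction, since neither \<open>1\<close> nor \<open>-1\<close> is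
  an eigenvalue there. So \<open>b\<close> is multiplied by some \<open>\<sigma> < 1\<close> up to terms of order \<open>\<epsilon>\<close>, and \<open>c\<close> likewise, up to
  an additional term of order \<open>b\<close>, which stems from the motion of the positions under mixing.

  Hence for a large weight \<open>A\<close> and all small \<open>\<epsilon>\<close> the function \<open>V + A b\<^sup>2 + c\<^sup>2\<close> is multiplied by at most
  \<open>1 - \<kappa> \<epsilon>\<close> in each step (\<open>perturbed_cascade_lyapunov\<close>, applied to \<open>one_step_estimates\<close>). It bounds the
  squared distance of every agent from the minimizer, so the rate \<open>sqrt (1 - \<kappa> \<epsilon>)\<close> results. All the
  estimates are global: the admissible step sizes do not depend on \<open>r\<close>.
\<close>

section \<open>Symmetric matrices and the Loewner order\<close>

text \<open>For a symmetric matrix the operator norm is the largest absolute value of the quadratic form on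
  the unit sphere. This turns two-sided form bounds into norm bounds, for the Hessians as well as
  for the consensus matrix.\<close>

lemma norm_matrix_vector_le_of_quadratic_form:
  fixes A :: "real^'m^'m"
  assumes sym: "transpose A = A"
    and bound: "\<And>v. \<bar>v \<bullet> (A *v v)\<bar> \<le> c * (norm v)\<^sup>2"
  shows "norm (A *v v) \<le> c * norm v"
proof (cases "A *v v = 0 \<or> v = 0")
  case True
  have "0 \<le> c * norm v" if "v \<noteq> 0"
  proof -
    have "0 \<le> c * (norm v)\<^sup>2"
      using bound[of v] by (meson abs_ge_zero order_trans)
    with that have "0 \<le> c"
      by (simp add: zero_le_mult_iff)
    then show ?thesis by simp
  qed
  with True show ?thesis by (cases "v = 0") auto
next
  case False
  \<comment> \<open>Polarise the form at v and at the vector u of the same length that is aligned with A v.\<close>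
  define u where "u = (norm v / norm (A *v v)) *\<^sub>R (A *v v)"
  have norm_u: "norm u = norm v"
    using False by (simp add: u_def)
  have swap: "v \<bullet> (A *v u) = u \<bullet> (A *v v)"
    by (metis dot_lmul_matrix inner_commute sym transpose_matrix_vector)
  have "4 * (u \<bullet> (A *v v)) = (u + v) \<bullet> (A *v (u + v)) - (u - v) \<bullet> (A *v (u - v))"
    by (simp add: matrix_vector_right_distrib matrix_vector_mult_diff_distrib
        inner_simps swap)
  also have "\<dots> \<le> c * (norm (u + v))\<^sup>2 + c * (norm (u - v))\<^sup>2"
    using bound[of "u + v"] bound[of "u - v"] by linarith
  also have "\<dots> = c * (2 * (norm u)\<^sup>2 + 2 * (norm v)\<^sup>2)"
    by (simp add: power2_norm_eq_inner inner_simps inner_commute algebra_simps)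
  finally have "u \<bullet> (A *v v) \<le> c * (norm v)\<^sup>2"
    by (simp add: norm_u)
  moreover have "u \<bullet> (A *v v) = norm v * norm (A *v v)"
    by (simp add: u_def power2_norm_eq_inner[symmetric] power2_eq_square)
  ultimately have "norm v * norm (A *v v) \<le> norm v * (c * norm v)"
    by (simp add: power2_eq_square mult_ac)
  then show ?thesis
    using False by simp
qed

lemma inner_mat_mult [simp]: "v \<bullet> (mat c *v v) = c * (norm (v::real^'m))\<^sup>2"
proof -
  have "mat c *v v = c *\<^sub>R v"
    by (simp add: vec_eq_iff matrix_vector_mult_def mat_def if_distrib[where f="\<lambda>x. x * _"] cong: if_cong)
  then show ?thesis by (simp add: power2_norm_eq_inner)
qed

lemma loewner_le_mat_iff:
  fixes A :: "real^'m^'m"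
  shows "A \<preceq>\<^sub>L mat c \<longleftrightarrow> transpose A = A \<and> (\<forall>v. v \<bullet> (A *v v) \<le> c * (norm v)\<^sup>2)"
    and "mat c \<preceq>\<^sub>L A \<longleftrightarrow> transpose A = A \<and> (\<forall>v. c * (norm v)\<^sup>2 \<le> v \<bullet> (A *v v))"
proof -
  have "transpose (mat c - A) = mat c - A \<longleftrightarrow> transpose A = A"
    by (auto simp: vec_eq_iff transpose_def mat_def) (metis diff_left_imp_eq)+
  then show "A \<preceq>\<^sub>L mat c \<longleftrightarrow> transpose A = A \<and> (\<forall>v. v \<bullet> (A *v v) \<le> c * (norm v)\<^sup>2)"
    by (simp add: loewner_le_def pos_semidef_def matrix_vector_mult_diff_rdistrib inner_diff_right)
  have "transpose (A - mat c) = A - mat c \<longleftrightarrow> transpose A = A"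
    by (auto simp: vec_eq_iff transpose_def mat_def) metis
  then show "mat c \<preceq>\<^sub>L A \<longleftrightarrow> transpose A = A \<and> (\<forall>v. c * (norm v)\<^sup>2 \<le> v \<bullet> (A *v v))"
    by (simp add: loewner_le_def pos_semidef_def matrix_vector_mult_diff_rdistrib inner_diff_right)
qed

text \<open>Symmetry of the inverse is not needed: with \<open>u = A z\<close>, the lower form bound controls
  \<open>z\<close> by \<open>u\<close>, and the upper norm bound controls \<open>u\<close> by \<open>z\<close>.\<close>

lemma matrix_inv_bounds:
  fixes A :: "real^'m^'m"
  assumes "\<mu> > 0" "L > 0"
    and lower: "\<And>v. \<mu> * (norm v)\<^sup>2 \<le> v \<bullet> (A *v v)"
    and upper: "\<And>v. norm (A *v v) \<le> L * norm v"
  shows "norm (matrix_inv A *v u) \<le> norm u / \<mu>"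
    and "\<mu> / L\<^sup>2 * (norm u)\<^sup>2 \<le> u \<bullet> (matrix_inv A *v u)"
proof -
  have "v = 0" if "A *v v = 0" for v
    using lower[of v] that \<open>\<mu> > 0\<close> by (simp add: mult_le_0_iff)
  then have "invertible A"
    by (metis invertible_left_inverse matrix_left_invertible_ker)
  then have "A ** matrix_inv A = mat 1"
    unfolding matrix_inv_def invertible_def by (metis (mono_tags, lifting) someI_ex)
  then obtain z where z: "z = matrix_inv A *v u" "A *v z = u"
    by (metis matrix_vector_mul_assoc matrix_vector_mul_lid)
  have "\<mu> * (norm z)\<^sup>2 \<le> norm z * norm u"
    using lower[of z] z(2) norm_cauchy_schwarz[of z u] by simp
  then have "\<mu> * norm z \<le> norm u"
    by (cases "z = 0") (simp_all add: power2_eq_square)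
  then show "norm (matrix_inv A *v u) \<le> norm u / \<mu>"
    using \<open>\<mu> > 0\<close> z(1) by (simp add: field_simps)
  have "(norm u)\<^sup>2 \<le> (L * norm z)\<^sup>2"
    using upper[of z] z(2) by (intro power_mono) auto
  then have "\<mu> / L\<^sup>2 * (norm u)\<^sup>2 \<le> \<mu> * (norm z)\<^sup>2"
    using \<open>\<mu> > 0\<close> \<open>L > 0\<close> by (simp add: field_simps)
  also have "\<dots> \<le> u \<bullet> z"
    using lower[of z] z(2) by (simp add: inner_commute)
  finally show "\<mu> / L\<^sup>2 * (norm u)\<^sup>2 \<le> u \<bullet> (matrix_inv A *v u)"
    using z(1) by simp
qed

section \<open>Contraction of the consensus matrix\<close>

lemma consensus_matrix_sums:
  assumes "consensus_matrix E P"
  shows "(\<Sum>j\<in>UNIV. P $ i $ j) = 1" and "(\<Sum>i\<in>UNIV. P $ i $ j) = 1" and "P $ i $ j \<ge> 0"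
proof -
  have "P *v 1 = 1" "transpose P = P" "\<forall>i j. if (i, j) \<in> E then P $ i $ j > 0 else P $ i $ j = 0"
    using assms by (auto simp: consensus_matrix_def)
  then show *: "(\<Sum>j\<in>UNIV. P $ i $ j) = 1" for i
    by (simp add: vec_eq_iff matrix_vector_mult_def)
  show "(\<Sum>i\<in>UNIV. P $ i $ j) = 1"
    using *[of j] \<open>transpose P = P\<close> by (simp add: vec_eq_iff transpose_def)
  show "P $ i $ j \<ge> 0"
    using \<open>\<forall>i j. _\<close> by (metis less_le order_refl)
qed

lemma norm_consensus_matrix_mult_le:
  fixes P :: "real^'n^'n"
  assumes "consensus_matrix E P"
  shows "norm (P *v z) \<le> norm z"
proof -
  note P = consensus_matrix_sums[OF assms]
  have "\<bar>v \<bullet> (P *v v)\<bar> \<le> 1 * (norm v)\<^sup>2" for v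
  proof -
    have "\<bar>v \<bullet> (P *v v)\<bar> = \<bar>\<Sum>i\<in>UNIV. \<Sum>j\<in>UNIV. P $ i $ j * (v $ i * v $ j)\<bar>"
      by (simp add: inner_vec_def matrix_vector_mult_def sum_distrib_left mult_ac)
    also have "\<dots> \<le> (\<Sum>i\<in>UNIV. \<Sum>j\<in>UNIV. \<bar>P $ i $ j * (v $ i * v $ j)\<bar>)"
      by (rule order_trans[OF sum_abs]) (intro sum_mono sum_abs)
    \<comment> \<open>Young's inequality; the row and column sums then make each half a sum of squares.\<close>
    also have "\<dots> \<le> (\<Sum>i\<in>UNIV. \<Sum>j\<in>UNIV. P $ i $ j * (((v $ i)\<^sup>2 + (v $ j)\<^sup>2) / 2))"
    proof (intro sum_mono)
      fix i j
      have "\<bar>v $ i * v $ j\<bar> \<le> ((v $ i)\<^sup>2 + (v $ j)\<^sup>2) / 2"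
        using sum_squares_bound[of "\<bar>v $ i\<bar>" "\<bar>v $ j\<bar>"] by (simp add: abs_mult)
      then show "\<bar>P $ i $ j * (v $ i * v $ j)\<bar> \<le> P $ i $ j * (((v $ i)\<^sup>2 + (v $ j)\<^sup>2) / 2)"
        using P(3)[of i j] by (metis abs_mult abs_of_nonneg mult_left_mono)
    qed
    also have "\<dots> = (\<Sum>i\<in>UNIV. \<Sum>j\<in>UNIV. P $ i $ j * ((v $ i)\<^sup>2 / 2)) +
        (\<Sum>i\<in>UNIV. \<Sum>j\<in>UNIV. P $ i $ j * ((v $ j)\<^sup>2 / 2))"
      by (simp add: sum.distrib[symmetric] add_divide_distrib distrib_left)
    also have "(\<Sum>i\<in>UNIV. \<Sum>j\<in>UNIV. P $ i $ j * ((v $ j)\<^sup>2 / 2)) =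
        (\<Sum>j\<in>UNIV. \<Sum>i\<in>UNIV. P $ i $ j * ((v $ j)\<^sup>2 / 2))"
      by (rule sum.swap)
    finally show ?thesis
      by (simp add: sum_distrib_right[symmetric] P(1,2) norm_vec_def L2_set_def sum_nonneg
          sum_divide_distrib[symmetric])
  qed
  moreover have "transpose P = P"
    using assms by (simp add: consensus_matrix_def)
  ultimately show ?thesis
    using norm_matrix_vector_le_of_quadratic_form[of P 1 z] by simp
qed

text \<open>If \<open>P\<close> preserved the length of \<open>z\<close>, then \<open>P (P z) = z\<close>, so \<open>z + P z\<close> would lie in the
  kernel of \<open>I - P\<close>, that is, be a multiple of \<open>1\<close>. Being orthogonal to \<open>1\<close>, it would vanish,
  making \<open>z\<close> an eigenvector of eigenvalue \<open>-1\<close>.\<close>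

lemma consensus_matrix_strict_contraction:
  fixes P :: "real^'n^'n"
  assumes "consensus_matrix E P"
    and no_eigenvalue: "\<And>v. P *v v = - v \<Longrightarrow> v = 0"
    and "1 \<bullet> z = 0" "z \<noteq> 0"
  shows "norm (P *v z) < norm z"
proof (rule ccontr)
  assume "\<not> norm (P *v z) < norm z"
  then have eq: "norm (P *v z) = norm z"
    using norm_consensus_matrix_mult_le[OF assms(1), of z] by linarith
  have P: "transpose P = P" "P *v 1 = 1" "{v. (mat 1 - P) *v v = 0} = span {1}"
    using assms(1) by (auto simp: consensus_matrix_def)
  have selfadj: "(P *v v) \<bullet> w = v \<bullet> (P *v w)" for v w
    by (metis dot_lmul_matrix P(1) transpose_matrix_vector)
  have "(norm (P *v (P *v z) - z))\<^sup>2 = (norm (P *v (P *v z)))\<^sup>2 - 2 * (norm (P *v z))\<^sup>2 + (norm z)\<^sup>2"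
    by (simp add: power2_norm_eq_inner inner_simps selfadj inner_commute)
  also have "\<dots> \<le> 0"
    using norm_consensus_matrix_mult_le[OF assms(1), of "P *v z"] eq by (simp add: power_mono)
  finally have PPz: "P *v (P *v z) = z" by simp
  define y where "y = z + P *v z"
  have "(mat 1 - P) *v y = 0"
    by (simp add: y_def matrix_vector_mult_diff_rdistrib matrix_vector_right_distrib PPz)
  then have "y \<in> span {1}" using P(3) by blast
  then obtain c where c: "y = c *\<^sub>R 1" by (auto simp: span_singleton)
  have "1 \<bullet> y = 0"
    using assms(3) selfadj[of 1 z] P(2) by (simp add: y_def inner_add_right)
  then have "y = 0"
    using c by (metis inner_eq_zero_iff inner_scaleR_left mult_eq_0_iff)
  then have "z = 0"
    using no_eigenvalue[of z] by (simp add: y_def add_eq_0_iff)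
  then show False using \<open>z \<noteq> 0\<close> by simp
qed

text \<open>Compactness of the unit sphere in the orthogonal complement of \<open>1\<close> makes the strict contraction
  uniform.\<close>

lemma consensus_matrix_contraction:
  fixes P :: "real^'n^'n"
  assumes "consensus_matrix E P" and "\<And>v. P *v v = - v \<Longrightarrow> v = 0"
  shows "\<exists>\<sigma>\<ge>0. \<sigma> < 1 \<and> (\<forall>z. 1 \<bullet> z = 0 \<longrightarrow> norm (P *v z) \<le> \<sigma> * norm z)"
proof -
  define S where "S = sphere 0 1 \<inter> {z :: real^'n. 1 \<bullet> z = 0}"
  have "compact S"
    unfolding S_def by (intro compact_Int_closed compact_sphere closed_hyperplane)
  moreover have "continuous_on S (\<lambda>z. norm (P *v z))"
    by (intro continuous_intros)
  ultimately obtain \<sigma> where \<sigma>: "0 \<le> \<sigma>" "\<sigma> < 1" "\<And>z. z \<in> S \<Longrightarrow> norm (P *v z) \<le> \<sigma>"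
  proof (cases "S = {}")
    \<comment> \<open>A single agent: the orthogonal complement of 1 is trivial.\<close>
    case True
    then show ?thesis using that[of 0] by simp
  next
    case False
    then obtain z0 where z0: "z0 \<in> S" "\<And>z. z \<in> S \<Longrightarrow> norm (P *v z) \<le> norm (P *v z0)"
      using continuous_attains_sup[OF \<open>compact S\<close> False \<open>continuous_on S _\<close>] by blast
    have "norm (P *v z0) < norm z0"
      using z0(1) by (intro consensus_matrix_strict_contraction[OF assms]) (auto simp: S_def)
    then show ?thesis
      using that[of "norm (P *v z0)"] z0 by (auto simp: S_def)
  qed
  show ?thesis
  proof (intro exI[of _ \<sigma>] conjI allI impI \<sigma>(1,2))
    fix z :: "real^'n" assume z: "1 \<bullet> z = 0"
    show "norm (P *v z) \<le> \<sigma> * norm z"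
    proof (cases "z = 0")
      case False
      then have "(1 / norm z) *\<^sub>R z \<in> S"
        using z by (simp add: S_def)
      from \<sigma>(3)[OF this] False show ?thesis
        by (simp add: matrix_vector_mult_scaleR field_simps)
    qed simp
  qed
qed

text \<open>A family of \<open>n\<close> vectors in \<open>\<real>\<^sup>d\<close> is stored as the matrix of type \<open>real^'d^'n\<close> whose rows are
  the vectors. Its norm is the Euclidean norm of the stacked vector, and mixing with \<open>P\<close> is the
  matrix product \<open>P ** z\<close>, which acts on each column separately.\<close>

lemma norm_eq_sum_columns: "(norm (z :: real^'d^'n))\<^sup>2 = (\<Sum>j\<in>UNIV. (norm (column j z))\<^sup>2)"
proof -
  have "(norm z)\<^sup>2 = (\<Sum>i\<in>UNIV. \<Sum>j\<in>UNIV. (z $ i $ j)\<^sup>2)"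
    by (simp add: norm_vec_def L2_set_def sum_nonneg)
  also have "\<dots> = (\<Sum>j\<in>UNIV. \<Sum>i\<in>UNIV. (z $ i $ j)\<^sup>2)"
    by (rule sum.swap)
  finally show ?thesis
    by (simp add: norm_vec_def L2_set_def sum_nonneg column_def)
qed

lemma norm_matrix_mult_le_of_columns:
  fixes z :: "real^'d^'n" and P :: "real^'n^'m"
  assumes "0 \<le> c" "\<And>j. norm (P *v column j z) \<le> c * norm (column j z)"
  shows "norm (P ** z) \<le> c * norm z"
proof (rule power2_le_imp_le)
  have col: "column j (P ** z) = P *v column j z" for j
    by (simp add: vec_eq_iff column_def matrix_matrix_mult_def matrix_vector_mult_def)
  have "(norm (P ** z))\<^sup>2 \<le> (\<Sum>j\<in>UNIV. (c * norm (column j z))\<^sup>2)"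
    unfolding norm_eq_sum_columns[of "P ** z"] col using assms by (intro sum_mono power_mono) auto
  then show "(norm (P ** z))\<^sup>2 \<le> (c * norm z)\<^sup>2"
    by (simp add: power_mult_distrib norm_eq_sum_columns[of z] sum_distrib_left)
qed (use assms in simp)

section \<open>Gradients\<close>

lemma GDERIV_mean_value:
  assumes "\<And>x. GDERIV F x :> G x"
  obtains t where "0 \<le> t" "t \<le> 1" "F y - F x = (y - x) \<bullet> G (x + t *\<^sub>R (y - x))"
proof -
  have "\<exists>t\<in>{0..1::real}. F (x + 1 *\<^sub>R (y - x)) - F (x + 0 *\<^sub>R (y - x)) =
      ((1 - 0) *\<^sub>R (y - x)) \<bullet> G (x + t *\<^sub>R (y - x))"
  proof (rule mvt_very_simple[where f = "\<lambda>t. F (x + t *\<^sub>R (y - x))"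
        and f' = "\<lambda>t h. (h *\<^sub>R (y - x)) \<bullet> G (x + t *\<^sub>R (y - x))"])
    fix t :: real
    have "(F has_derivative (\<lambda>h. h \<bullet> G (x + t *\<^sub>R (y - x)))) (at (x + t *\<^sub>R (y - x)))"
      using assms by (simp add: gderiv_def)
    then show "((\<lambda>t. F (x + t *\<^sub>R (y - x))) has_derivative
        (\<lambda>h. (h *\<^sub>R (y - x)) \<bullet> G (x + t *\<^sub>R (y - x)))) (at t within {0..1})"
      by (rule has_derivative_compose[rotated]) (auto intro!: derivative_eq_intros)
  qed simp
  then show thesis using that by auto
qed

lemma GDERIV_lipschitz_upper_bound:
  assumes grad: "\<And>x. GDERIV F x :> G x"
    and lip: "\<And>x y. norm (G x - G y) \<le> L * norm (x - y)" and "0 \<le> L"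
  shows "F y \<le> F x + (y - x) \<bullet> G x + L * (norm (y - x))\<^sup>2"
proof -
  obtain t where t: "0 \<le> t" "t \<le> 1" "F y - F x = (y - x) \<bullet> G (x + t *\<^sub>R (y - x))"
    by (rule GDERIV_mean_value[of F G y x, OF grad])
  have "norm (G (x + t *\<^sub>R (y - x)) - G x) \<le> L * (t * norm (y - x))"
    using lip[of "x + t *\<^sub>R (y - x)" x] t(1) by simp
  also have "\<dots> \<le> L * norm (y - x)"
    using t \<open>0 \<le> L\<close> by (intro mult_left_mono) (auto intro: mult_left_le_one_le)
  finally have "(y - x) \<bullet> (G (x + t *\<^sub>R (y - x)) - G x) \<le> norm (y - x) * (L * norm (y - x))"
    by (intro order_trans[OF norm_cauchy_schwarz] mult_left_mono) auto
  then show ?thesis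
    using t(3) by (simp add: inner_diff_right power2_eq_square algebra_simps)
qed

lemma GDERIV_monotone_lower_bound:
  assumes grad: "\<And>x. GDERIV F x :> G x"
    and mono: "\<And>x y. 0 \<le> (x - y) \<bullet> (G x - G y)"
  shows "F y - F x \<le> (y - x) \<bullet> G y"
proof -
  obtain t where t: "0 \<le> t" "t \<le> 1" "F y - F x = (y - x) \<bullet> G (x + t *\<^sub>R (y - x))"
    by (rule GDERIV_mean_value[of F G y x, OF grad])
  \<comment> \<open>Monotonicity along the segment compares the gradient at z with the one at y.\<close>
  define z where "z = x + t *\<^sub>R (y - x)"
  have yz: "y - z = (1 - t) *\<^sub>R (y - x)"
    by (simp add: z_def algebra_simps)
  have "0 \<le> (y - x) \<bullet> (G y - G z)"
  proof (cases "t = 1")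
    case True
    then have "z = y" by (simp add: z_def)
    then show ?thesis by simp
  next
    case False
    then show ?thesis
      using mono[of y z] t(2) by (simp add: yz zero_le_mult_iff)
  qed
  then show ?thesis
    using t(3) by (simp add: z_def inner_diff_right)
qed

lemma gderiv_gradient:
  fixes f :: "'a::euclidean_space \<Rightarrow> real"
  assumes "f differentiable at x"
  shows "GDERIV f x :> gradient f x"
proof -
  obtain f' where f': "(f has_derivative f') (at x)"
    using assms by (auto simp: differentiable_def)
  have "f' h = h \<bullet> (\<Sum>b\<in>Basis. f' b *\<^sub>R b)" for h
  proof -
    have "f' h = f' (\<Sum>b\<in>Basis. (h \<bullet> b) *\<^sub>R b)"
      by (simp add: euclidean_representation)
    also have "\<dots> = (\<Sum>b\<in>Basis. (h \<bullet> b) * f' b)"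
      using has_derivative_linear[OF f'] by (simp add: linear_sum linear_scale)
    finally show ?thesis
      by (simp add: inner_sum_right mult.commute)
  qed
  then have "GDERIV f x :> (\<Sum>b\<in>Basis. f' b *\<^sub>R b)"
    using f' unfolding gderiv_def by (metis (no_types, lifting) ext)
  then show ?thesis
    using gradient_eqI by metis
qed

lemma gradient_has_derivative_hessian:
  assumes "continuously_differentiable (gradient f)"
  shows "(gradient f has_derivative (*v) (hessian f x)) (at x)"
proof -
  have "gradient f differentiable at x"
    using assms by (auto simp: continuously_differentiable_def differentiable_def)
  then show ?thesis
    by (simp add: jacobian_works hessian_def)
qed

text \<open>The lower bound on the Hessian enters through the mean value theorem applied to the component of
  the gradient along the segment.\<close>

lemma gradient_bounds:
  fixes f :: "real^'d \<Rightarrow> real"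
  assumes C1: "continuously_differentiable (gradient f)"
    and "0 < \<mu>" "0 < L"
    and hess: "\<And>x. mat \<mu> \<preceq>\<^sub>L hessian f x \<and> hessian f x \<preceq>\<^sub>L mat L"
  shows norm_hessian_le: "norm (hessian f x *v v) \<le> L * norm v"
    and gradient_lipschitz: "norm (gradient f x - gradient f y) \<le> L * norm (x - y)"
    and gradient_strongly_monotone: "\<mu> * (norm (x - y))\<^sup>2 \<le> (x - y) \<bullet> (gradient f x - gradient f y)"
proof -
  have hess': "transpose (hessian f x) = hessian f x"
      "\<mu> * (norm v)\<^sup>2 \<le> v \<bullet> (hessian f x *v v)" "v \<bullet> (hessian f x *v v) \<le> L * (norm v)\<^sup>2" for x v
    using hess[of x] by (auto simp: loewner_le_mat_iff)
  have "\<bar>v \<bullet> (hessian f x *v v)\<bar> \<le> L * (norm v)\<^sup>2" for x v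
  proof -
    have "0 \<le> \<mu> * (norm v)\<^sup>2" using \<open>0 < \<mu>\<close> by simp
    with hess'(2,3)[of v x] show ?thesis by linarith
  qed
  then show norm_le: "norm (hessian f x *v v) \<le> L * norm v" for x v
    by (intro norm_matrix_vector_le_of_quadratic_form hess'(1))
  note deriv = gradient_has_derivative_hessian[OF C1]
  show "norm (gradient f x - gradient f y) \<le> L * norm (x - y)"
  proof (rule differentiable_bound[OF convex_UNIV])
    show "onorm ((*v) (hessian f z)) \<le> L" for z
      by (rule onorm_le) (rule norm_le)
  qed (use deriv in auto)
  have "\<exists>t\<in>{0..1::real}. (x - y) \<bullet> gradient f (y + 1 *\<^sub>R (x - y)) - (x - y) \<bullet> gradient f (y + 0 *\<^sub>R (x - y)) =
      (x - y) \<bullet> (hessian f (y + t *\<^sub>R (x - y)) *v ((1 - 0) *\<^sub>R (x - y)))"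
  proof (rule mvt_very_simple[where f = "\<lambda>t. (x - y) \<bullet> gradient f (y + t *\<^sub>R (x - y))"
        and f' = "\<lambda>t h. (x - y) \<bullet> (hessian f (y + t *\<^sub>R (x - y)) *v (h *\<^sub>R (x - y)))"])
    fix t :: real
    have "((\<lambda>t. gradient f (y + t *\<^sub>R (x - y))) has_derivative
        (\<lambda>h. hessian f (y + t *\<^sub>R (x - y)) *v (h *\<^sub>R (x - y)))) (at t within {0..1})"
      by (rule has_derivative_compose[OF _ deriv]) (auto intro!: derivative_eq_intros)
    then show "((\<lambda>t. (x - y) \<bullet> gradient f (y + t *\<^sub>R (x - y))) has_derivative
        (\<lambda>h. (x - y) \<bullet> (hessian f (y + t *\<^sub>R (x - y)) *v (h *\<^sub>R (x - y))))) (at t within {0..1})"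
      by (rule has_derivative_inner_right)
  qed simp
  then obtain t where "(x - y) \<bullet> (gradient f x - gradient f y) =
      (x - y) \<bullet> (hessian f (y + t *\<^sub>R (x - y)) *v (x - y))"
    by (auto simp: inner_diff_right)
  then show "\<mu> * (norm (x - y))\<^sup>2 \<le> (x - y) \<bullet> (gradient f x - gradient f y)"
    using hess'(2) by simp
qed

section \<open>A Lyapunov function for a perturbed cascade\<close>

text \<open>Convexity of the square, with weights \<open>\<sigma>\<close> and \<open>1 - \<sigma>\<close>.\<close>

lemma square_perturbed_contraction_le:
  fixes \<sigma> :: real
  assumes "0 \<le> \<sigma>" "\<sigma> < 1"
  shows "(\<sigma> * p + q)\<^sup>2 \<le> \<sigma> * p\<^sup>2 + q\<^sup>2 / (1 - \<sigma>)"
proof -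
  have "0 \<le> \<sigma> * (q - (1 - \<sigma>) * p)\<^sup>2 / (1 - \<sigma>)"
    using assms by simp
  also have "\<dots> = \<sigma> * p\<^sup>2 + q\<^sup>2 / (1 - \<sigma>) - (\<sigma> * p + q)\<^sup>2"
    using assms by (simp add: divide_simps) (simp add: algebra_simps power2_eq_square)
  finally show ?thesis by simp
qed

text \<open>Two contractions with factor \<open>\<sigma>\<close>, for \<open>b\<close> and \<open>c\<close>, the first feeding into the second, are coupled
  through terms of order \<open>\<epsilon>\<close> to a quantity \<open>V\<close> that descends at rate \<open>\<epsilon> G\<^sup>2\<close>. The influence of
  \<open>b\<close> on \<open>c\<close> is of order one, so \<open>b\<^sup>2\<close> must be weighted by a large constant \<open>A\<close>; all the other
  couplings are absorbed once \<open>\<epsilon>\<close> is small.\<close>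

lemma perturbed_cascade_lyapunov:
  fixes \<sigma> K m :: real
  assumes \<sigma>: "0 \<le> \<sigma>" "\<sigma> < 1" and "1 \<le> K" "0 < m"
  obtains A \<epsilon>bar \<kappa> where "0 < A" "0 < \<epsilon>bar" "0 < \<kappa>" "\<And>\<epsilon>. \<epsilon> \<le> \<epsilon>bar \<Longrightarrow> \<kappa> * \<epsilon> \<le> 1 / 2"
    "\<And>\<epsilon> V G b c V' b' c'.
       \<lbrakk>0 < \<epsilon>; \<epsilon> \<le> \<epsilon>bar; 0 \<le> b; 0 \<le> c; 0 \<le> G; 0 \<le> b'; 0 \<le> c'; V \<le> K * G\<^sup>2;
        V' \<le> V - \<epsilon> * m * G\<^sup>2 + \<epsilon> * K * G * (b + c) + \<epsilon>\<^sup>2 * K * (b + c + G)\<^sup>2;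
        b' \<le> \<sigma> * b + \<epsilon> * K * (b + c + G);
        c' \<le> \<sigma> * c + K * b + \<epsilon> * K * (b + c + G)\<rbrakk>
       \<Longrightarrow> V' + A * b'\<^sup>2 + c'\<^sup>2 \<le> (1 - \<kappa> * \<epsilon>) * (V + A * b\<^sup>2 + c\<^sup>2)"
proof -
  define T where "T = 1 / (1 - \<sigma>)"
  have T: "0 < T" using \<sigma> by (simp add: T_def)
  \<comment> \<open>This choice makes the weighted loss of b pay for its influence on c, with 1 to spare.\<close>
  define A where "A = T * (2 * T * K\<^sup>2 + 1)"
  have A: "0 < A" using T by (simp add: A_def add_nonneg_pos)
  have A_eq: "A * \<sigma> + 2 * T * K\<^sup>2 = A - 1"
  proof -
    have "A * (1 - \<sigma>) = (T * (1 - \<sigma>)) * (2 * T * K\<^sup>2 + 1)"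
      by (simp add: A_def)
    also have "T * (1 - \<sigma>) = 1"
      using \<sigma> by (simp add: T_def)
    finally show ?thesis by (simp add: algebra_simps)
  qed
  define Q where "Q = 3 * (K + A * T * K\<^sup>2 + 2 * T * K\<^sup>2)"
  have Q: "0 < Q" using \<open>1 \<le> K\<close> T A by (simp add: Q_def add_pos_nonneg)
  define \<epsilon>bar where "\<epsilon>bar = min 1 (min (m / (4 * Q)) ((1 - \<sigma>) / (2 * (K\<^sup>2 / m + Q))))"
  have KQ: "0 < K\<^sup>2 / m + Q"
    using Q \<open>0 < m\<close> by (simp add: add_nonneg_pos)
  have \<epsilon>bar: "0 < \<epsilon>bar"
    using Q KQ \<sigma> \<open>0 < m\<close> by (simp add: \<epsilon>bar_def)
  define \<kappa> where "\<kappa> = min (m / (4 * K)) (min (1 / (2 * A)) ((1 - \<sigma>) / 2))"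
  have \<kappa>: "0 < \<kappa>" "\<kappa> \<le> m / (4 * K)" "\<kappa> \<le> 1 / (2 * A)" "\<kappa> \<le> (1 - \<sigma>) / 2"
  proof -
    show "0 < \<kappa>"
      using A \<sigma> \<open>1 \<le> K\<close> \<open>0 < m\<close> by (simp add: \<kappa>_def)
    show "\<kappa> \<le> m / (4 * K)" "\<kappa> \<le> 1 / (2 * A)" "\<kappa> \<le> (1 - \<sigma>) / 2"
      unfolding \<kappa>_def by linarith+
  qed
  show thesis
  proof (rule that[OF A \<epsilon>bar \<kappa>(1)])
    fix \<epsilon> assume "\<epsilon> \<le> \<epsilon>bar"
    then have "\<epsilon> \<le> 1" by (simp add: \<epsilon>bar_def)
    then have "\<kappa> * \<epsilon> \<le> \<kappa>" using \<kappa>(1) by simp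
    then show "\<kappa> * \<epsilon> \<le> 1 / 2" using \<kappa>(4) \<sigma>(1) by simp
  next
    fix \<epsilon> V G b c V' b' c' :: real
    assume \<epsilon>: "0 < \<epsilon>" "\<epsilon> \<le> \<epsilon>bar" and nonneg: "0 \<le> b" "0 \<le> c" "0 \<le> G" "0 \<le> b'" "0 \<le> c'"
      and V: "V \<le> K * G\<^sup>2"
      and V': "V' \<le> V - \<epsilon> * m * G\<^sup>2 + \<epsilon> * K * G * (b + c) + \<epsilon>\<^sup>2 * K * (b + c + G)\<^sup>2"
      and b': "b' \<le> \<sigma> * b + \<epsilon> * K * (b + c + G)"
      and c': "c' \<le> \<sigma> * c + K * b + \<epsilon> * K * (b + c + G)"
    define S where "S = b\<^sup>2 + c\<^sup>2 + G\<^sup>2"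
    have S: "(b + c + G)\<^sup>2 \<le> 3 * S"
    proof -
      have "0 \<le> (b - c)\<^sup>2 + (b - G)\<^sup>2 + (c - G)\<^sup>2" by simp
      then show ?thesis by (simp add: S_def power2_eq_square algebra_simps)
    qed
    have \<epsilon>1: "\<epsilon> \<le> 1" "\<epsilon> * Q \<le> m / 4" "\<epsilon> * (K\<^sup>2 / m + Q) \<le> (1 - \<sigma>) / 2"
      using \<epsilon>(2) Q KQ by (simp_all add: \<epsilon>bar_def field_simps)
    have "b'\<^sup>2 \<le> (\<sigma> * b + \<epsilon> * K * (b + c + G))\<^sup>2"
      using nonneg b' by (intro power_mono)
    also have "\<dots> \<le> \<sigma> * b\<^sup>2 + T * (\<epsilon> * K * (b + c + G))\<^sup>2"
      using square_perturbed_contraction_le[OF \<sigma>] by (simp add: T_def)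
    also have "(\<epsilon> * K * (b + c + G))\<^sup>2 = \<epsilon>\<^sup>2 * K\<^sup>2 * (b + c + G)\<^sup>2"
      by (simp add: power_mult_distrib)
    also have "\<sigma> * b\<^sup>2 + T * \<dots> \<le> \<sigma> * b\<^sup>2 + T * (\<epsilon>\<^sup>2 * K\<^sup>2 * (3 * S))"
      using T by (intro add_left_mono mult_left_mono S) auto
    finally have "A * b'\<^sup>2 \<le> A * (\<sigma> * b\<^sup>2 + T * (\<epsilon>\<^sup>2 * K\<^sup>2 * (3 * S)))"
      using A by (intro mult_left_mono) auto
    moreover have "c'\<^sup>2 \<le> \<sigma> * c\<^sup>2 + T * (2 * (K\<^sup>2 * b\<^sup>2) + 2 * (\<epsilon>\<^sup>2 * K\<^sup>2 * (3 * S)))"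
    proof -
      have "c'\<^sup>2 \<le> (\<sigma> * c + (K * b + \<epsilon> * K * (b + c + G)))\<^sup>2"
        using nonneg c' by (intro power_mono) auto
      also have "\<dots> \<le> \<sigma> * c\<^sup>2 + T * (K * b + \<epsilon> * K * (b + c + G))\<^sup>2"
        using square_perturbed_contraction_le[OF \<sigma>] by (simp add: T_def)
      also have "(K * b + \<epsilon> * K * (b + c + G))\<^sup>2 \<le> 2 * (K * b)\<^sup>2 + 2 * (\<epsilon> * K * (b + c + G))\<^sup>2"
        using sum_squares_bound[of "K * b" "\<epsilon> * K * (b + c + G)"] by (simp add: power2_sum)
      also have "\<dots> = 2 * (K\<^sup>2 * b\<^sup>2) + 2 * (\<epsilon>\<^sup>2 * K\<^sup>2 * (b + c + G)\<^sup>2)"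
        by (simp add: power_mult_distrib)
      also have "\<dots> \<le> 2 * (K\<^sup>2 * b\<^sup>2) + 2 * (\<epsilon>\<^sup>2 * K\<^sup>2 * (3 * S))"
        by (intro add_left_mono mult_left_mono S) auto
      finally show ?thesis using T by auto
    qed
    moreover have "\<epsilon>\<^sup>2 * K * (b + c + G)\<^sup>2 \<le> \<epsilon>\<^sup>2 * K * (3 * S)"
      using \<open>1 \<le> K\<close> by (intro mult_left_mono S) auto
    moreover have "\<epsilon> * K * G * (b + c) \<le> \<epsilon> * (m / 2 * G\<^sup>2 + K\<^sup>2 / m * (b\<^sup>2 + c\<^sup>2))"
    proof -
      \<comment> \<open>Young's inequality together with the bound of (b + c) squared by twice the sum of squares.\<close>
      have "0 \<le> (m * G - K * (b + c))\<^sup>2 + (K * (b - c))\<^sup>2" by simp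
      then have "K * G * (b + c) \<le> m / 2 * G\<^sup>2 + K\<^sup>2 / m * (b\<^sup>2 + c\<^sup>2)"
        using \<open>0 < m\<close> by (simp add: field_simps power2_eq_square)
      then have "\<epsilon> * (K * G * (b + c)) \<le> \<epsilon> * (m / 2 * G\<^sup>2 + K\<^sup>2 / m * (b\<^sup>2 + c\<^sup>2))"
        using \<epsilon>(1) by (intro mult_left_mono) auto
      then show ?thesis by (simp add: mult.assoc)
    qed
    ultimately have "V' + A * b'\<^sup>2 + c'\<^sup>2 \<le> V - \<epsilon> * m * G\<^sup>2 + \<epsilon> * (m / 2 * G\<^sup>2 + K\<^sup>2 / m * (b\<^sup>2 + c\<^sup>2))
        + \<epsilon>\<^sup>2 * K * (3 * S) + A * (\<sigma> * b\<^sup>2 + T * (\<epsilon>\<^sup>2 * K\<^sup>2 * (3 * S)))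
        + (\<sigma> * c\<^sup>2 + T * (2 * (K\<^sup>2 * b\<^sup>2) + 2 * (\<epsilon>\<^sup>2 * K\<^sup>2 * (3 * S))))"
      using V' by linarith
    also have "\<dots> = V - \<epsilon> * (m / 2) * G\<^sup>2 + \<epsilon> * (K\<^sup>2 / m) * (b\<^sup>2 + c\<^sup>2)
        + (A * \<sigma> + 2 * T * K\<^sup>2) * b\<^sup>2 + \<sigma> * c\<^sup>2 + \<epsilon> * (\<epsilon> * Q) * S"
      by (simp add: Q_def algebra_simps power2_eq_square add_divide_distrib)
    also have "\<dots> = V - \<epsilon> * (m / 2 - \<epsilon> * Q) * G\<^sup>2 + (A - 1 + \<epsilon> * (K\<^sup>2 / m + \<epsilon> * Q)) * b\<^sup>2
        + (\<sigma> + \<epsilon> * (K\<^sup>2 / m + \<epsilon> * Q)) * c\<^sup>2"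
      unfolding A_eq by (simp add: S_def algebra_simps)
    also have "\<dots> \<le> V - \<epsilon> * \<kappa> * V + (A - \<epsilon> * \<kappa> * A) * b\<^sup>2 + (1 - \<epsilon> * \<kappa>) * c\<^sup>2"
    proof -
      have "\<epsilon> * \<kappa> * V \<le> \<epsilon> * \<kappa> * (K * G\<^sup>2)"
        using V \<epsilon> \<kappa> by (intro mult_left_mono) auto
      also have "\<dots> = \<epsilon> * (\<kappa> * K) * G\<^sup>2" by simp
      also have "\<dots> \<le> \<epsilon> * (m / 2 - \<epsilon> * Q) * G\<^sup>2"
        using \<kappa>(2) \<epsilon>(1) \<epsilon>1(2) \<open>1 \<le> K\<close> by (intro mult_right_mono mult_left_mono) (auto simp: field_simps)
      finally have 1: "V - \<epsilon> * (m / 2 - \<epsilon> * Q) * G\<^sup>2 \<le> V - \<epsilon> * \<kappa> * V" by simp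
      have "\<epsilon> * (\<epsilon> * Q) \<le> \<epsilon> * (1 * Q)"
        using \<epsilon>(1) \<epsilon>1(1) Q by (intro mult_left_mono mult_right_mono) auto
      then have X: "\<epsilon> * (K\<^sup>2 / m + \<epsilon> * Q) \<le> (1 - \<sigma>) / 2"
        using \<epsilon>1(3) by (simp add: distrib_left)
      have k: "\<epsilon> * \<kappa> \<le> \<kappa>"
        using \<epsilon>1(1) \<kappa>(1) by simp
      then have "\<epsilon> * \<kappa> * A \<le> \<kappa> * A" using A by (intro mult_right_mono) auto
      also have "\<dots> \<le> 1 / 2" using \<kappa>(3) A by (simp add: field_simps)
      finally have "\<epsilon> * \<kappa> * A \<le> 1 / 2" .
      have 2: "(A - 1 + \<epsilon> * (K\<^sup>2 / m + \<epsilon> * Q)) * b\<^sup>2 \<le> (A - \<epsilon> * \<kappa> * A) * b\<^sup>2"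
      proof (rule mult_right_mono)
        have "\<epsilon> * (K\<^sup>2 / m + \<epsilon> * Q) \<le> 1 / 2"
          using X \<sigma> by simp
        then show "A - 1 + \<epsilon> * (K\<^sup>2 / m + \<epsilon> * Q) \<le> A - \<epsilon> * \<kappa> * A"
          using \<open>\<epsilon> * \<kappa> * A \<le> 1 / 2\<close> by linarith
      qed simp
      have 3: "(\<sigma> + \<epsilon> * (K\<^sup>2 / m + \<epsilon> * Q)) * c\<^sup>2 \<le> (1 - \<epsilon> * \<kappa>) * c\<^sup>2"
      proof (rule mult_right_mono)
        have "\<epsilon> * (K\<^sup>2 / m + \<epsilon> * Q) + \<epsilon> * \<kappa> \<le> (1 - \<sigma>) / 2 + (1 - \<sigma>) / 2"
          using X order_trans[OF k \<kappa>(4)] by (rule add_mono)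
        also have "\<dots> = 1 - \<sigma>"
          by simp
        finally show "\<sigma> + \<epsilon> * (K\<^sup>2 / m + \<epsilon> * Q) \<le> 1 - \<epsilon> * \<kappa>"
          by linarith
      qed simp
      show ?thesis using 1 2 3 by linarith
    qed
    also have "\<dots> = (1 - \<kappa> * \<epsilon>) * (V + A * b\<^sup>2 + c\<^sup>2)"
      by (simp add: algebra_simps)
    finally show "V' + A * b'\<^sup>2 + c'\<^sup>2 \<le> (1 - \<kappa> * \<epsilon>) * (V + A * b\<^sup>2 + c\<^sup>2)" .
  qed
qed

section \<open>Averages and deviations from consensus\<close>

text \<open>The mean of the rows of a stacked vector.\<close>

definition avg :: "real^'d^'n \<Rightarrow> real^'d" where
  "avg z = (1 / real CARD('n)) *\<^sub>R (\<Sum>i\<in>UNIV. z $ i)"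

text \<open>The stacked vector in which all agents hold the same value.\<close>

definition replicate_vec :: "real^'d \<Rightarrow> real^'d^'n" where
  "replicate_vec m = (\<chi> i. m)"

text \<open>The disagreement of a stacked vector: what remains of it after its mean is subtracted from every row.\<close>

definition dev :: "real^'d^'n \<Rightarrow> real^'d^'n" where
  "dev z = z - replicate_vec (avg z)"

lemma replicate_vec_nth [simp]: "replicate_vec m $ i = m"
  by (simp add: replicate_vec_def)

lemma avg_linear:
  "avg (y + z) = avg y + avg z" "avg (y - z) = avg y - avg z" "avg (c *\<^sub>R z) = c *\<^sub>R avg z"
  by (simp_all add: avg_def sum.distrib sum_subtractf scaleR_sum_right algebra_simps)

lemma avg_replicate_vec [simp]: "avg (replicate_vec m) = m"
  by (simp add: avg_def sum_constant_scaleR del: sum_constant)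

lemma dev_nth: "z $ i = avg z + dev z $ i"
  by (simp add: dev_def)

lemma dev_linear:
  "dev (y + z) = dev y + dev z" "dev (y - z) = dev y - dev z" "dev (c *\<^sub>R z) = c *\<^sub>R dev z"
  by (simp_all add: dev_def avg_linear vec_eq_iff algebra_simps)

lemma dev_replicate_vec [simp]: "dev (replicate_vec m) = 0"
  by (simp add: dev_def)

lemma sum_dev: "(\<Sum>i\<in>UNIV. dev z $ i) = 0"
  by (simp add: dev_def avg_def sum_subtractf sum_constant_scaleR del: sum_constant)

lemma norm_replicate_vec_le: "norm (replicate_vec m :: real^'d^'n) \<le> real CARD('n) * norm m"
proof -
  have "norm (replicate_vec m :: real^'d^'n) \<le> (\<Sum>i\<in>(UNIV :: 'n set). norm m)"
    unfolding norm_vec_def by (rule order_trans[OF L2_set_le_sum]) simp_all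
  then show ?thesis by simp
qed

lemma norm_avg_le: "norm (avg z) \<le> norm z"
proof -
  have "norm (\<Sum>i\<in>UNIV. z $ i) \<le> (\<Sum>i\<in>(UNIV :: 'b set). norm z)"
    by (intro order_trans[OF norm_sum] sum_mono Finite_Cartesian_Product.norm_nth_le)
  then show ?thesis by (simp add: avg_def field_simps)
qed

lemma norm_dev_le: "norm (dev z) \<le> norm z" for z :: "real^'d^'n"
proof (rule power2_le_imp_le)
  have "dev z \<bullet> replicate_vec (avg z) = (\<Sum>i\<in>UNIV. dev z $ i \<bullet> avg z)"
    by (subst inner_vec_def) simp
  also have "\<dots> = (\<Sum>i\<in>UNIV. dev z $ i) \<bullet> avg z"
    by (simp only: inner_sum_left)
  finally have "dev z \<bullet> replicate_vec (avg z) = 0"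
    by (simp add: sum_dev)
  moreover have "z = dev z + replicate_vec (avg z)"
    by (simp add: dev_def)
  ultimately have "(norm z)\<^sup>2 = (norm (dev z))\<^sup>2 + (norm (replicate_vec (avg z) :: real^'d^'n))\<^sup>2"
    using norm_add_Pythagorean[of "dev z" "replicate_vec (avg z)"] by (simp add: orthogonal_def)
  then show "(norm (dev z))\<^sup>2 \<le> (norm z)\<^sup>2" by simp
qed simp

lemma norm_vec_le_componentwise:
  fixes y :: "'a::real_normed_vector^'n" and z :: "'b::real_normed_vector^'n"
  assumes "0 \<le> c" "\<And>i. norm (y $ i) \<le> c * norm (z $ i)"
  shows "norm y \<le> c * norm z"
proof -
  have "norm y \<le> L2_set (\<lambda>i. c * norm (z $ i)) UNIV"
    unfolding norm_vec_def by (intro L2_set_mono assms) simp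
  also have "\<dots> = c * norm z"
    using assms(1) by (simp add: norm_vec_def L2_set_right_distrib)
  finally show ?thesis .
qed

lemma matrix_mult_nth: "(P ** z) $ i = (\<Sum>j\<in>UNIV. P $ i $ j *\<^sub>R z $ j)"
  for P :: "real^'n^'m" and z :: "real^'d^'n"
  by (simp add: vec_eq_iff matrix_matrix_mult_def)

lemma matrix_mult_diff_right: "P ** (y - z) = P ** y - P ** z"
  for P :: "real^'n^'m" and y z :: "real^'d^'n"
  by (simp add: vec_eq_iff matrix_mult_nth sum_subtractf scaleR_diff_right algebra_simps)

section \<open>One step of the network Newton iteration\<close>

text \<open>The properties of the problem on which the analysis depends: \<open>g i\<close> is the gradient of \<open>f i\<close>, the
  matrices \<open>D i x\<close> (the inverse Hessians, in the application) are bounded and uniformly coercive,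
  and \<open>P\<close> preserves the mean and contracts disagreements by the factor \<open>\<sigma>\<close>.\<close>

locale network_newton =
  fixes f :: "'n::finite \<Rightarrow> real^'d \<Rightarrow> real"
    and g :: "'n \<Rightarrow> real^'d \<Rightarrow> real^'d"
    and D :: "'n \<Rightarrow> real^'d \<Rightarrow> real^'d^'d"
    and P :: "real^'n^'n"
    and \<sigma> \<mu> L m :: real
    and xstar :: "real^'d"
  assumes pos: "0 < \<mu>" "0 < L" "0 < m" and \<sigma>: "0 \<le> \<sigma>" "\<sigma> < 1"
    and grad: "\<And>i x. GDERIV (f i) x :> g i x"
    and g_lipschitz: "\<And>i x y. norm (g i x - g i y) \<le> L * norm (x - y)"
    and g_mono: "\<And>i x y. \<mu> * (norm (x - y))\<^sup>2 \<le> (x - y) \<bullet> (g i x - g i y)"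
    and D_bound: "\<And>i x v. norm (D i x *v v) \<le> norm v / \<mu>"
    and D_coercive: "\<And>i x v. m * (norm v)\<^sup>2 \<le> v \<bullet> (D i x *v v)"
    and P_rows: "\<And>i. (\<Sum>j\<in>UNIV. P $ i $ j) = 1"
    and P_cols: "\<And>j. (\<Sum>i\<in>UNIV. P $ i $ j) = 1"
    and P_nonexpansive: "\<And>z :: real^'d^'n. norm (P ** z) \<le> norm z"
    and P_contraction: "\<And>z :: real^'d^'n. norm (P ** dev z) \<le> \<sigma> * norm (dev z)"
    and minimizer: "\<And>x. (\<Sum>i\<in>UNIV. f i xstar) \<le> (\<Sum>i\<in>UNIV. f i x)"
begin

text \<open>The global objective, the mean of the local ones.\<close>

definition F :: "real^'d \<Rightarrow> real" where
  "F x = (1 / real CARD('n)) * (\<Sum>i\<in>UNIV. f i x)"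

text \<open>The gradient of the global objective.\<close>

definition gradF :: "real^'d \<Rightarrow> real^'d" where
  "gradF x = (1 / real CARD('n)) *\<^sub>R (\<Sum>i\<in>UNIV. g i x)"

text \<open>The stacked local gradients, each taken at the position of its own agent.\<close>

definition gs :: "real^'d^'n \<Rightarrow> real^'d^'n" where
  "gs x = (\<chi> i. g i (x $ i))"

text \<open>The local directions: each agent applies its own matrix, taken at its own position.\<close>

definition Ds :: "real^'d^'n \<Rightarrow> real^'d^'n \<Rightarrow> real^'d^'n" where
  "Ds x y = (\<chi> i. D i (x $ i) *v y $ i)"

lemma avg_mix: "avg (P ** z) = avg z"
proof -
  have "(\<Sum>i\<in>UNIV. \<Sum>j\<in>UNIV. P $ i $ j *\<^sub>R z $ j) = (\<Sum>j\<in>UNIV. \<Sum>i\<in>UNIV. P $ i $ j *\<^sub>R z $ j)"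
    by (rule sum.swap)
  then show ?thesis
    by (simp add: avg_def matrix_mult_nth scaleR_sum_left[symmetric] P_cols)
qed

lemma mix_replicate_vec: "P ** replicate_vec v = replicate_vec v"
proof (rule vec_eq_iff[THEN iffD2], rule allI)
  show "(P ** replicate_vec v) $ i = replicate_vec v $ i" for i
    by (simp add: matrix_mult_nth scaleR_sum_left[symmetric] P_rows)
qed

lemma dev_mix: "dev (P ** z) = P ** dev z"
  by (simp add: dev_def matrix_mult_diff_right avg_mix mix_replicate_vec)

lemma norm_dev_mix_le: "norm (dev (P ** z)) \<le> \<sigma> * norm (dev z)" for z :: "real^'d^'n"
  by (simp add: dev_mix P_contraction)

lemma gs_lipschitz: "norm (gs x - gs y) \<le> L * norm (x - y)"
  by (rule norm_vec_le_componentwise) (use pos in \<open>simp_all add: gs_def g_lipschitz\<close>)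

lemma norm_Ds_le: "norm (Ds x y) \<le> norm y / \<mu>"
  using norm_vec_le_componentwise[of "1 / \<mu>" "Ds x y" y] pos D_bound by (simp add: Ds_def)

lemma avg_gs_replicate_vec: "avg (gs (replicate_vec x)) = gradF x"
  by (simp add: avg_def gs_def gradF_def)

lemma gradF: "GDERIV F x :> gradF x"
proof -
  have "((\<lambda>x. (1 / real CARD('n)) * (\<Sum>i\<in>UNIV. f i x)) has_derivative
      (\<lambda>h. (1 / real CARD('n)) * (\<Sum>i\<in>UNIV. h \<bullet> g i x))) (at x)"
    using grad by (intro has_derivative_mult_right has_derivative_sum) (simp add: gderiv_def)
  then show ?thesis
    by (simp add: gderiv_def F_def[abs_def] gradF_def inner_sum_right)
qed

lemma gradF_lipschitz: "norm (gradF x - gradF y) \<le> L * norm (x - y)"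
proof -
  have "norm (gradF x - gradF y) = norm (\<Sum>i\<in>UNIV. g i x - g i y) / real CARD('n)"
    by (simp add: gradF_def sum_subtractf scaleR_diff_right[symmetric])
  also have "\<dots> \<le> (\<Sum>i\<in>(UNIV :: 'n set). L * norm (x - y)) / real CARD('n)"
    by (intro divide_right_mono order_trans[OF norm_sum] sum_mono g_lipschitz) simp
  finally show ?thesis by simp
qed

lemma gradF_strongly_monotone: "\<mu> * (norm (x - y))\<^sup>2 \<le> (x - y) \<bullet> (gradF x - gradF y)"
proof -
  have "(\<Sum>i\<in>(UNIV :: 'n set). \<mu> * (norm (x - y))\<^sup>2) \<le> (\<Sum>i\<in>UNIV. (x - y) \<bullet> (g i x - g i y))"
    by (intro sum_mono g_mono)
  then have "(1 / real CARD('n)) * (\<Sum>i\<in>(UNIV :: 'n set). \<mu> * (norm (x - y))\<^sup>2)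
      \<le> (1 / real CARD('n)) * (\<Sum>i\<in>UNIV. (x - y) \<bullet> (g i x - g i y))"
    by (intro mult_left_mono) auto
  also have "\<dots> = (x - y) \<bullet> (gradF x - gradF y)"
    by (simp add: gradF_def scaleR_diff_right[symmetric] sum_subtractf[symmetric] inner_sum_right)
  finally show ?thesis by simp
qed

lemma F_minimal: "F xstar \<le> F x"
  using minimizer[of x] by (simp add: F_def divide_right_mono)

lemma gradF_xstar: "gradF xstar = 0"
proof -
  have "(\<lambda>h. h \<bullet> gradF xstar) = (\<lambda>h. 0)"
    using gradF[of xstar] F_minimal unfolding gderiv_def
    by (intro differential_zero_maxmin[of xstar UNIV F]) auto
  then show ?thesis by (metis inner_eq_zero_iff)
qed

lemma norm_error_le_gradF: "\<mu> * norm (x - xstar) \<le> norm (gradF x)"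
proof -
  have "\<mu> * (norm (x - xstar))\<^sup>2 \<le> norm (x - xstar) * norm (gradF x)"
    using gradF_strongly_monotone[of x xstar] norm_cauchy_schwarz[of "x - xstar" "gradF x"]
    by (simp add: gradF_xstar)
  then show ?thesis
    by (cases "x = xstar") (simp_all add: power2_eq_square)
qed

text \<open>The Polyak-Lojasiewicz inequality and its converse: the optimality gap is comparable to the
  squared gradient.\<close>

lemma F_gap_le: "F x - F xstar \<le> (norm (gradF x))\<^sup>2 / \<mu>"
proof -
  have "0 \<le> (x - y) \<bullet> (gradF x - gradF y)" for x y
    by (rule order_trans[OF _ gradF_strongly_monotone]) (use pos in simp)
  then have "F x - F xstar \<le> (x - xstar) \<bullet> gradF x"
    by (intro GDERIV_monotone_lower_bound gradF)
  also have "\<dots> \<le> norm (x - xstar) * norm (gradF x)"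
    by (rule norm_cauchy_schwarz)
  also have "\<dots> \<le> (norm (gradF x) / \<mu>) * norm (gradF x)"
    using norm_error_le_gradF[of x] pos by (intro mult_right_mono) (simp_all add: field_simps)
  finally show ?thesis by (simp add: power2_eq_square)
qed

lemma gradF_le_F_gap: "(norm (gradF x))\<^sup>2 \<le> 4 * L * (F x - F xstar)"
proof -
  \<comment> \<open>Compare the minimum with the value after one gradient step from x.\<close>
  have "F xstar \<le> F (x - (1 / (2 * L)) *\<^sub>R gradF x)"
    by (rule F_minimal)
  also have "\<dots> \<le> F x - (1 / (2 * L)) * (norm (gradF x))\<^sup>2 + L * ((1 / (2 * L)) * norm (gradF x))\<^sup>2"
    using GDERIV_lipschitz_upper_bound[of F gradF L "x - (1 / (2 * L)) *\<^sub>R gradF x" x,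
        OF gradF gradF_lipschitz] pos
    by (simp add: power2_norm_eq_inner)
  also have "\<dots> = F x - (norm (gradF x))\<^sup>2 / (4 * L)"
    using pos by (simp add: power_mult_distrib power_divide power2_eq_square[of L] field_simps)
  finally show ?thesis using pos by (simp add: field_simps)
qed

lemma squared_error_le_F_gap: "(norm (x - xstar))\<^sup>2 \<le> 4 * L / \<mu>\<^sup>2 * (F x - F xstar)"
proof -
  have "(\<mu> * norm (x - xstar))\<^sup>2 \<le> (norm (gradF x))\<^sup>2"
    using pos by (intro power_mono norm_error_le_gradF) auto
  with gradF_le_F_gap[of x] show ?thesis
    using pos by (simp add: field_simps power_mult_distrib)
qed

text \<open>One iteration in terms of the positions \<open>x = x\<^sup>k\<close> and the trackers \<open>y = w\<^sup>k\<^sup>+\<^sup>1\<close>. The positions move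
  first; the trackers then correct for the change in the local gradients. This shift of index
  eliminates the stored gradients from the state, and it makes the mean of the trackers equal to
  the mean of the current local gradients.\<close>

definition step_x :: "real \<Rightarrow> real^'d^'n \<Rightarrow> real^'d^'n \<Rightarrow> real^'d^'n" where
  "step_x \<epsilon> x y = P ** (x - \<epsilon> *\<^sub>R Ds x y)"

definition step_y :: "real^'d^'n \<Rightarrow> real^'d^'n \<Rightarrow> real^'d^'n \<Rightarrow> real^'d^'n" where
  "step_y x x' y = P ** (y + gs x' - gs x)"

text \<open>In the one-step estimates the mean of the trackers equals the mean of the local
  gradients. It then differs from the gradient at the mean position only by disagreement.\<close>

lemma norm_tracker_deviation_le:
  assumes "avg y = avg (gs x)"
  shows "norm (avg y - gradF (avg x)) \<le> L * norm (dev x)"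
proof -
  have "avg y - gradF (avg x) = avg (gs x - gs (replicate_vec (avg x)))"
    by (simp add: assms avg_linear avg_gs_replicate_vec)
  then show ?thesis
    using norm_avg_le[of "gs x - gs (replicate_vec (avg x))"] gs_lipschitz[of x "replicate_vec (avg x)"]
    by (simp add: dev_def)
qed

lemma norm_Ds_tracker_le:
  assumes "avg y = avg (gs x)"
  shows "norm (Ds x y) \<le>
    (1 + real CARD('n) + real CARD('n) * L) / \<mu> * (norm (dev x) + norm (dev y) + norm (gradF (avg x)))"
    (is "_ \<le> ?M / \<mu> * ?s")
proof -
  have "norm (avg y) \<le> norm (gradF (avg x)) + norm (avg y - gradF (avg x))"
    by (rule norm_triangle_sub)
  also have "\<dots> \<le> norm (gradF (avg x)) + L * norm (dev x)"
    using norm_tracker_deviation_le[OF assms] by simp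
  also have "\<dots> \<le> ?s + L * ?s"
    using pos by (intro add_mono mult_left_mono) auto
  finally have avg_le: "norm (avg y) \<le> (1 + L) * ?s"
    by (simp add: distrib_right)
  have "norm y \<le> norm (dev y) + norm (replicate_vec (avg y) :: real^'d^'n)"
    using norm_triangle_ineq[of "dev y" "replicate_vec (avg y)"] by (simp add: dev_def)
  also have "\<dots> \<le> ?s + real CARD('n) * ((1 + L) * ?s)"
  proof (intro add_mono)
    show "norm (replicate_vec (avg y) :: real^'d^'n) \<le> real CARD('n) * ((1 + L) * ?s)"
      by (rule order_trans[OF norm_replicate_vec_le mult_left_mono[OF avg_le]]) simp
  qed auto
  also have "\<dots> = ?M * ?s"
    by (simp add: algebra_simps)
  finally have "norm y / \<mu> \<le> ?M * ?s / \<mu>"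
    using pos by (intro divide_right_mono) auto
  with norm_Ds_le[of x y] show ?thesis by simp
qed

text \<open>The mean direction is a descent direction up to disagreement: each \<open>D i (x $ i)\<close> is
  coercive, hence so is the mean of these matrices, although they belong to different positions.\<close>

lemma inner_gradF_avg_Ds_ge:
  assumes "avg y = avg (gs x)"
  shows "m * (norm (gradF (avg x)))\<^sup>2
      - norm (gradF (avg x)) * (norm (dev y) + L * norm (dev x)) / \<mu> \<le> gradF (avg x) \<bullet> avg (Ds x y)"
    (is "?lhs \<le> _")
proof -
  let ?G = "gradF (avg x)"
  have "?lhs \<le> ?G \<bullet> (D i (x $ i) *v y $ i)" for i
  proof -
    define r where "r = dev y $ i + (avg y - ?G)"
    have "norm r \<le> norm (dev y) + L * norm (dev x)"
      unfolding r_def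
      by (intro order_trans[OF norm_triangle_ineq] add_mono Finite_Cartesian_Product.norm_nth_le norm_tracker_deviation_le assms)
    then have "norm r / \<mu> \<le> (norm (dev y) + L * norm (dev x)) / \<mu>"
      using pos by (intro divide_right_mono) auto
    then have "norm (D i (x $ i) *v r) \<le> (norm (dev y) + L * norm (dev x)) / \<mu>"
      by (rule order_trans[OF D_bound])
    then have "norm ?G * norm (D i (x $ i) *v r) \<le> norm ?G * ((norm (dev y) + L * norm (dev x)) / \<mu>)"
      by (intro mult_left_mono) auto
    moreover have "- (?G \<bullet> (D i (x $ i) *v r)) \<le> norm ?G * norm (D i (x $ i) *v r)"
      using norm_cauchy_schwarz[of "- ?G"] by simp
    moreover have "y $ i = ?G + r"
      using dev_nth[of y i] by (simp add: r_def)
    ultimately show ?thesis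
      using D_coercive[of ?G i "x $ i"] by (simp add: matrix_vector_right_distrib inner_add_right)
  qed
  then have "(\<Sum>i\<in>(UNIV :: 'n set). ?lhs) \<le> (\<Sum>i\<in>UNIV. ?G \<bullet> (D i (x $ i) *v y $ i))"
    by (intro sum_mono)
  then have "(1 / real CARD('n)) * (\<Sum>i\<in>(UNIV :: 'n set). ?lhs)
      \<le> (1 / real CARD('n)) * (\<Sum>i\<in>UNIV. ?G \<bullet> (D i (x $ i) *v y $ i))"
    by (intro mult_left_mono) auto
  then show ?thesis
    by (simp add: avg_def Ds_def inner_sum_right)
qed

text \<open>A bound on the stacked directions, relative to the sum of the three error measures.\<close>

definition M :: real where
  "M = (1 + real CARD('n) + real CARD('n) * L) / \<mu>"

text \<open>One constant that dominates all the coefficients arising in a single step.\<close>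

definition K :: real where
  "K = 1 + M + 2 * L + L * M + (1 + L) / \<mu> + L * M\<^sup>2 + 1 / \<mu>"

lemma M_nonneg: "0 \<le> M"
  using pos by (simp add: M_def)

lemma K_bounds: "1 \<le> K" "M \<le> K" "2 * L \<le> K" "L * M \<le> K" "(1 + L) / \<mu> \<le> K" "L * M\<^sup>2 \<le> K" "1 / \<mu> \<le> K"
proof -
  have "0 \<le> M" "0 \<le> 2 * L" "0 \<le> L * M" "0 \<le> (1 + L) / \<mu>" "0 \<le> L * M\<^sup>2" "0 \<le> 1 / \<mu>"
    using pos M_nonneg by auto
  then show "1 \<le> K" "M \<le> K" "2 * L \<le> K" "L * M \<le> K" "(1 + L) / \<mu> \<le> K" "L * M\<^sup>2 \<le> K" "1 / \<mu> \<le> K"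
    unfolding K_def by linarith+
qed

lemma one_step_estimates:
  assumes avg_y: "avg y = avg (gs x)" and "0 \<le> \<epsilon>"
  defines "x' \<equiv> step_x \<epsilon> x y"
  defines "y' \<equiv> step_y x x' y"
  defines "G \<equiv> norm (gradF (avg x))"
  defines "s \<equiv> norm (dev x) + norm (dev y) + G"
  shows "avg y' = avg (gs x')"
    and "norm (dev x') \<le> \<sigma> * norm (dev x) + \<epsilon> * K * s"
    and "norm (dev y') \<le> \<sigma> * norm (dev y) + K * norm (dev x) + \<epsilon> * K * s"
    and "F (avg x') \<le> F (avg x) - \<epsilon> * m * G\<^sup>2 + \<epsilon> * K * G * (norm (dev x) + norm (dev y))
      + \<epsilon>\<^sup>2 * K * s\<^sup>2"
proof -
  have s: "0 \<le> s" "norm (Ds x y) \<le> M * s"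
    using norm_Ds_tracker_le[OF avg_y] by (simp_all add: s_def G_def M_def)
  have Ks: "\<epsilon> * M * s \<le> \<epsilon> * K * s" "\<epsilon> * (L * M) * s \<le> \<epsilon> * K * s"
    using K_bounds s(1) \<open>0 \<le> \<epsilon>\<close> by (auto intro!: mult_right_mono mult_left_mono)
  have eDs: "norm (\<epsilon> *\<^sub>R Ds x y) \<le> \<epsilon> * M * s"
    using s(2) \<open>0 \<le> \<epsilon>\<close> by (simp add: mult.assoc mult_left_mono)
  show "avg y' = avg (gs x')"
    by (simp add: y'_def step_y_def avg_mix avg_linear avg_y)
  have "norm (dev x') \<le> \<sigma> * norm (dev x - dev (\<epsilon> *\<^sub>R Ds x y))"
    using norm_dev_mix_le[of "x - \<epsilon> *\<^sub>R Ds x y"] by (simp only: x'_def step_x_def dev_linear(2))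
  also have "\<dots> \<le> \<sigma> * (norm (dev x) + \<epsilon> * M * s)"
    using \<sigma> norm_triangle_ineq4[of "dev x" "dev (\<epsilon> *\<^sub>R Ds x y)"] norm_dev_le[of "\<epsilon> *\<^sub>R Ds x y"] eDs
    by (intro mult_left_mono) auto
  also have "\<dots> \<le> \<sigma> * norm (dev x) + \<epsilon> * M * s"
    using \<sigma> s \<open>0 \<le> \<epsilon>\<close> M_nonneg by (simp add: distrib_left mult_left_le_one_le)
  finally show "norm (dev x') \<le> \<sigma> * norm (dev x) + \<epsilon> * K * s"
    using Ks by linarith
  have move: "norm (x' - x) \<le> 2 * norm (dev x) + \<epsilon> * M * s"
  proof -
    have "x' - x = P ** dev x - dev x - P ** (\<epsilon> *\<^sub>R Ds x y)"
      by (simp add: x'_def step_x_def dev_def matrix_mult_diff_right mix_replicate_vec)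
    also have "norm \<dots> \<le> norm (P ** dev x) + norm (dev x) + norm (P ** (\<epsilon> *\<^sub>R Ds x y))"
      by (intro order_trans[OF norm_triangle_ineq4] add_right_mono norm_triangle_ineq4)
    also have "\<dots> \<le> norm (dev x) + norm (dev x) + \<epsilon> * M * s"
      using P_nonexpansive[of "dev x"] P_nonexpansive[of "\<epsilon> *\<^sub>R Ds x y"] eDs by linarith
    finally show ?thesis by simp
  qed
  have "norm (dev y') \<le> \<sigma> * norm (dev (y + (gs x' - gs x)))"
    using norm_dev_mix_le[of "y + (gs x' - gs x)"] by (simp only: y'_def step_y_def add_diff_eq)
  also have "\<dots> \<le> \<sigma> * (norm (dev y) + L * (2 * norm (dev x) + \<epsilon> * M * s))"
  proof (rule mult_left_mono)
    have "norm (dev (gs x' - gs x)) \<le> L * norm (x' - x)"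
      by (rule order_trans[OF norm_dev_le gs_lipschitz])
    also have "\<dots> \<le> L * (2 * norm (dev x) + \<epsilon> * M * s)"
      using move pos by (intro mult_left_mono) auto
    finally show "norm (dev (y + (gs x' - gs x))) \<le> norm (dev y) + L * (2 * norm (dev x) + \<epsilon> * M * s)"
      by (simp only: dev_linear(1)) (intro order_trans[OF norm_triangle_ineq] add_left_mono)
  qed (rule \<sigma>)
  also have "\<dots> \<le> \<sigma> * norm (dev y) + L * (2 * norm (dev x) + \<epsilon> * M * s)"
    using \<sigma> s \<open>0 \<le> \<epsilon>\<close> M_nonneg pos by (simp only: distrib_left[of \<sigma>]) (intro add_left_mono mult_left_le_one_le, auto)
  also have "\<dots> = \<sigma> * norm (dev y) + 2 * L * norm (dev x) + \<epsilon> * (L * M) * s"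
    by (simp add: algebra_simps)
  also have "\<dots> \<le> \<sigma> * norm (dev y) + K * norm (dev x) + \<epsilon> * K * s"
    using Ks mult_right_mono[OF K_bounds(3), of "norm (dev x)"] by simp
  finally show "norm (dev y') \<le> \<sigma> * norm (dev y) + K * norm (dev x) + \<epsilon> * K * s" .
  have avg_x': "avg x' - avg x = - (\<epsilon> *\<^sub>R avg (Ds x y))"
    by (simp add: x'_def step_x_def avg_mix avg_linear)
  have "norm (avg x' - avg x) \<le> \<epsilon> * M * s"
    unfolding avg_x' using norm_avg_le[of "\<epsilon> *\<^sub>R Ds x y"] eDs by (simp add: avg_linear)
  then have "(norm (avg x' - avg x))\<^sup>2 \<le> (\<epsilon> * M * s)\<^sup>2"
    by (intro power_mono) auto
  then have "L * (norm (avg x' - avg x))\<^sup>2 \<le> L * (\<epsilon> * M * s)\<^sup>2"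
    using pos by (intro mult_left_mono) auto
  also have "\<dots> = (L * M\<^sup>2) * (\<epsilon>\<^sup>2 * s\<^sup>2)"
    by (simp add: power_mult_distrib)
  also have "\<dots> \<le> K * (\<epsilon>\<^sup>2 * s\<^sup>2)"
    using K_bounds by (intro mult_right_mono) auto
  finally have quad: "L * (norm (avg x' - avg x))\<^sup>2 \<le> \<epsilon>\<^sup>2 * K * s\<^sup>2"
    by (simp add: mult_ac)
  have "(norm (dev y) + L * norm (dev x)) / \<mu> \<le> (1 + L) / \<mu> * (norm (dev x) + norm (dev y))"
    using pos by (simp add: field_simps)
  also have "\<dots> \<le> K * (norm (dev x) + norm (dev y))"
    using K_bounds by (intro mult_right_mono) auto
  finally have "G * ((norm (dev y) + L * norm (dev x)) / \<mu>) \<le> G * (K * (norm (dev x) + norm (dev y)))"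
    by (intro mult_left_mono) (auto simp: G_def)
  with inner_gradF_avg_Ds_ge[OF avg_y]
  have "m * G\<^sup>2 - G * (K * (norm (dev x) + norm (dev y))) \<le> gradF (avg x) \<bullet> avg (Ds x y)"
    by (simp add: G_def)
  then have "\<epsilon> * (m * G\<^sup>2 - G * (K * (norm (dev x) + norm (dev y)))) \<le> \<epsilon> * (gradF (avg x) \<bullet> avg (Ds x y))"
    using \<open>0 \<le> \<epsilon>\<close> by (rule mult_left_mono)
  then have "(avg x' - avg x) \<bullet> gradF (avg x) \<le> - (\<epsilon> * m * G\<^sup>2) + \<epsilon> * K * G * (norm (dev x) + norm (dev y))"
    unfolding avg_x' by (simp add: inner_commute algebra_simps)
  moreover have "F (avg x') \<le> F (avg x) + (avg x' - avg x) \<bullet> gradF (avg x) + L * (norm (avg x' - avg x))\<^sup>2"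
    using pos by (intro GDERIV_lipschitz_upper_bound gradF gradF_lipschitz) auto
  ultimately show "F (avg x') \<le> F (avg x) - \<epsilon> * m * G\<^sup>2 + \<epsilon> * K * G * (norm (dev x) + norm (dev y))
      + \<epsilon>\<^sup>2 * K * s\<^sup>2"
    using quad by linarith
qed

section \<open>Exponential convergence\<close>

text \<open>The sequence of pairs \<open>(x\<^sup>k, w\<^sup>k\<^sup>+\<^sup>1)\<close>. At \<open>k = 0\<close> the stored gradients and trackers vanish, so the first
  tracker value is the mixed local gradients.\<close>

primrec iterates :: "real \<Rightarrow> real^'d^'n \<Rightarrow> nat \<Rightarrow> (real^'d^'n) \<times> (real^'d^'n)" where
  "iterates \<epsilon> x0 0 = (x0, P ** gs x0)"
| "iterates \<epsilon> x0 (Suc k) =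
     (let (x, y) = iterates \<epsilon> x0 k; x' = step_x \<epsilon> x y in (x', step_y x x' y))"

text \<open>The optimality gap of the mean position plus the weighted squared disagreements of positions and
  trackers.\<close>

definition lyapunov :: "real \<Rightarrow> (real^'d^'n) \<times> (real^'d^'n) \<Rightarrow> real" where
  "lyapunov A = (\<lambda>(x, y). (F (avg x) - F xstar) + A * (norm (dev x))\<^sup>2 + (norm (dev y))\<^sup>2)"

lemma lyapunov_decay:
  obtains A \<epsilon>bar \<kappa> where "0 < A" "0 < \<epsilon>bar" "0 < \<kappa>" "\<And>\<epsilon>. \<epsilon> \<le> \<epsilon>bar \<Longrightarrow> \<kappa> * \<epsilon> \<le> 1 / 2"
    "\<And>\<epsilon> x0 k. 0 < \<epsilon> \<Longrightarrow> \<epsilon> \<le> \<epsilon>bar \<Longrightarrow>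
       lyapunov A (iterates \<epsilon> x0 k) \<le> (1 - \<kappa> * \<epsilon>) ^ k * lyapunov A (x0, P ** gs x0)"
proof (rule perturbed_cascade_lyapunov[OF \<sigma> K_bounds(1) pos(3)])
  fix A \<epsilon>bar \<kappa> :: real
  assume params: "0 < A" "0 < \<epsilon>bar" "0 < \<kappa>" "\<And>\<epsilon>. \<epsilon> \<le> \<epsilon>bar \<Longrightarrow> \<kappa> * \<epsilon> \<le> 1 / 2"
    and decay: "\<And>\<epsilon> V G b c V' b' c'.
       \<lbrakk>0 < \<epsilon>; \<epsilon> \<le> \<epsilon>bar; 0 \<le> b; 0 \<le> c; 0 \<le> G; 0 \<le> b'; 0 \<le> c'; V \<le> K * G\<^sup>2;
        V' \<le> V - \<epsilon> * m * G\<^sup>2 + \<epsilon> * K * G * (b + c) + \<epsilon>\<^sup>2 * K * (b + c + G)\<^sup>2;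
        b' \<le> \<sigma> * b + \<epsilon> * K * (b + c + G);
        c' \<le> \<sigma> * c + K * b + \<epsilon> * K * (b + c + G)\<rbrakk>
       \<Longrightarrow> V' + A * b'\<^sup>2 + c'\<^sup>2 \<le> (1 - \<kappa> * \<epsilon>) * (V + A * b\<^sup>2 + c\<^sup>2)"
  have "lyapunov A (iterates \<epsilon> x0 k) \<le> (1 - \<kappa> * \<epsilon>) ^ k * lyapunov A (x0, P ** gs x0)"
    if \<epsilon>: "0 < \<epsilon>" "\<epsilon> \<le> \<epsilon>bar" for \<epsilon> x0 k
  proof -
    have avg_eq: "avg (snd (iterates \<epsilon> x0 k)) = avg (gs (fst (iterates \<epsilon> x0 k)))" for k
    proof (induction k)
      case (Suc k)
      then show ?case
        using one_step_estimates(1)[of _ _ \<epsilon>] \<epsilon> by (auto simp: Let_def split: prod.splits)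
    qed (simp add: avg_mix)
    show ?thesis
    proof (induction k)
      case (Suc k)
      obtain x y where xy: "iterates \<epsilon> x0 k = (x, y)" by fastforce
      have avg_y: "avg y = avg (gs x)" using avg_eq[of k] by (simp add: xy)
      define x' where "x' = step_x \<epsilon> x y"
      define y' where "y' = step_y x x' y"
      have "(F (avg x') - F xstar) + A * (norm (dev x'))\<^sup>2 + (norm (dev y'))\<^sup>2
          \<le> (1 - \<kappa> * \<epsilon>) * ((F (avg x) - F xstar) + A * (norm (dev x))\<^sup>2 + (norm (dev y))\<^sup>2)"
      proof (rule decay[OF \<epsilon>, where G = "norm (gradF (avg x))"])
        have "F (avg x) - F xstar \<le> (1 / \<mu>) * (norm (gradF (avg x)))\<^sup>2"
          using F_gap_le by simp
        also have "\<dots> \<le> K * (norm (gradF (avg x)))\<^sup>2"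
          using K_bounds by (intro mult_right_mono) auto
        finally show "F (avg x) - F xstar \<le> K * (norm (gradF (avg x)))\<^sup>2" .
      qed (use one_step_estimates[OF avg_y, of \<epsilon>] \<epsilon> in \<open>simp_all add: x'_def y'_def\<close>)
      then have "lyapunov A (iterates \<epsilon> x0 (Suc k)) \<le> (1 - \<kappa> * \<epsilon>) * lyapunov A (iterates \<epsilon> x0 k)"
        by (simp add: lyapunov_def xy x'_def y'_def Let_def)
      also have "\<dots> \<le> (1 - \<kappa> * \<epsilon>) * ((1 - \<kappa> * \<epsilon>) ^ k * lyapunov A (x0, P ** gs x0))"
        using Suc params(4)[OF \<epsilon>(2)] by (intro mult_left_mono) auto
      finally show ?case by (simp add: mult.assoc)
    qed simp
  qed
  then show thesis using that params by blast
qed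

text \<open>Only the constant \<open>C\<close> depends on the radius \<open>r\<close> of the set of initial positions.\<close>

lemma lyapunov_initial_bound:
  assumes "0 \<le> r" "0 < A"
  shows "\<exists>W\<ge>0. \<forall>x0. (\<forall>i. norm (x0 $ i - xstar) \<le> r) \<longrightarrow> lyapunov A (x0, P ** gs x0) \<le> W"
proof -
  define R where "R = real CARD('n) * r"
  define S where "S = norm (gs (replicate_vec xstar)) + L * R"
  define W where "W = (L * R)\<^sup>2 / \<mu> + A * R\<^sup>2 + S\<^sup>2"
  have "lyapunov A (x0, P ** gs x0) \<le> W" if x0: "\<forall>i. norm (x0 $ i - xstar) \<le> r" for x0
  proof -
    have "norm (x0 - replicate_vec xstar) \<le> (\<Sum>i\<in>UNIV. norm (x0 $ i - xstar))"
      unfolding norm_vec_def by (rule order_trans[OF L2_set_le_sum]) simp_all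
    also have "\<dots> \<le> (\<Sum>i\<in>(UNIV :: 'n set). r)"
      by (intro sum_mono x0[rule_format])
    finally have dist: "norm (x0 - replicate_vec xstar) \<le> R"
      by (simp add: R_def)
    have "norm (avg x0 - xstar) \<le> R"
      using norm_avg_le[of "x0 - replicate_vec xstar"] dist by (simp add: avg_linear)
    then have "L * norm (avg x0 - xstar) \<le> L * R"
      using pos by simp
    then have "norm (gradF (avg x0)) \<le> L * R"
      using gradF_lipschitz[of "avg x0" xstar] by (simp add: gradF_xstar)
    then have "(norm (gradF (avg x0)))\<^sup>2 / \<mu> \<le> (L * R)\<^sup>2 / \<mu>"
      using pos by (intro divide_right_mono power_mono) auto
    then have "F (avg x0) - F xstar \<le> (L * R)\<^sup>2 / \<mu>"
      using F_gap_le[of "avg x0"] by linarith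
    moreover have "norm (dev x0) \<le> R"
      using norm_dev_le[of "x0 - replicate_vec xstar"] dist by (simp add: dev_linear)
    then have "A * (norm (dev x0))\<^sup>2 \<le> A * R\<^sup>2"
      using assms by (intro mult_left_mono power_mono) auto
    moreover have "norm (dev (P ** gs x0)) \<le> S"
    proof -
      have "norm (dev (P ** gs x0)) \<le> norm (gs x0)"
        by (rule order_trans[OF norm_dev_le P_nonexpansive])
      also have "\<dots> \<le> norm (gs (replicate_vec xstar)) + norm (gs x0 - gs (replicate_vec xstar))"
        by (rule norm_triangle_sub)
      also have "norm (gs x0 - gs (replicate_vec xstar)) \<le> L * R"
        using gs_lipschitz[of x0 "replicate_vec xstar"] mult_left_mono[OF dist, of L] pos by linarith
      finally show ?thesis by (simp add: S_def)
    qed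
    then have "(norm (dev (P ** gs x0)))\<^sup>2 \<le> S\<^sup>2"
      by (intro power_mono) auto
    ultimately show ?thesis by (simp add: lyapunov_def W_def)
  qed
  moreover have "0 \<le> W"
    using assms pos by (simp add: W_def)
  ultimately show ?thesis by blast
qed

lemma squared_error_le_lyapunov:
  assumes "0 < A"
  shows "(norm (x $ i - xstar))\<^sup>2 \<le> (2 / A + 8 * L / \<mu>\<^sup>2) * lyapunov A (x, y)"
proof -
  have V: "lyapunov A (x, y) = (F (avg x) - F xstar) + A * (norm (dev x))\<^sup>2 + (norm (dev y))\<^sup>2"
    by (simp add: lyapunov_def)
  have nonneg: "0 \<le> F (avg x) - F xstar" "0 \<le> A * (norm (dev x))\<^sup>2" "0 \<le> (norm (dev y))\<^sup>2"
    using F_minimal assms by simp_all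
  have "norm (x $ i - xstar) \<le> norm (dev x) + norm (avg x - xstar)"
  proof -
    have "x $ i - xstar = dev x $ i + (avg x - xstar)"
      using dev_nth[of x i] by simp
    then have "norm (x $ i - xstar) = norm (dev x $ i + (avg x - xstar))"
      by (rule arg_cong)
    then show ?thesis
      using norm_triangle_ineq[of "dev x $ i" "avg x - xstar"]
        Finite_Cartesian_Product.norm_nth_le[of "dev x" i] by linarith
  qed
  then have "(norm (x $ i - xstar))\<^sup>2 \<le> (norm (dev x) + norm (avg x - xstar))\<^sup>2"
    by (intro power_mono) auto
  also have "\<dots> \<le> 2 * (norm (dev x))\<^sup>2 + 2 * (norm (avg x - xstar))\<^sup>2"
    using sum_squares_bound[of "norm (dev x)" "norm (avg x - xstar)"] by (simp add: power2_sum)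
  also have "\<dots> \<le> 2 / A * (A * (norm (dev x))\<^sup>2) + 8 * L / \<mu>\<^sup>2 * (F (avg x) - F xstar)"
    using squared_error_le_F_gap[of "avg x"] assms by simp
  also have "\<dots> \<le> 2 / A * lyapunov A (x, y) + 8 * L / \<mu>\<^sup>2 * lyapunov A (x, y)"
  proof (intro add_mono mult_left_mono)
    show "A * (norm (dev x))\<^sup>2 \<le> lyapunov A (x, y)" "F (avg x) - F xstar \<le> lyapunov A (x, y)"
      using nonneg unfolding V by linarith+
  qed (use assms pos in auto)
  finally show ?thesis by (simp add: distrib_right)
qed

lemma iterates_exponential_convergence:
  assumes "0 \<le> r"
  shows "\<exists>\<epsilon>bar>0. \<forall>\<epsilon>. 0 < \<epsilon> \<and> \<epsilon> \<le> \<epsilon>bar \<longrightarrow>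
           (\<exists>C \<gamma>. C > 0 \<and> 0 < \<gamma> \<and> \<gamma> < 1 \<and>
              (\<forall>x0. (\<forall>i. norm (x0 $ i - xstar) \<le> r) \<longrightarrow>
                 (\<forall>k i. norm (fst (iterates \<epsilon> x0 k) $ i - xstar) \<le> C * \<gamma> ^ k)))"
proof (rule lyapunov_decay)
  fix A \<epsilon>bar \<kappa> :: real
  assume params: "0 < A" "0 < \<epsilon>bar" "0 < \<kappa>" "\<And>\<epsilon>. \<epsilon> \<le> \<epsilon>bar \<Longrightarrow> \<kappa> * \<epsilon> \<le> 1 / 2"
    and decay: "\<And>\<epsilon> x0 k. 0 < \<epsilon> \<Longrightarrow> \<epsilon> \<le> \<epsilon>bar \<Longrightarrow>
       lyapunov A (iterates \<epsilon> x0 k) \<le> (1 - \<kappa> * \<epsilon>) ^ k * lyapunov A (x0, P ** gs x0)"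
  obtain W where "0 \<le> W"
    and W: "\<And>x0. \<forall>i. norm (x0 $ i - xstar) \<le> r \<Longrightarrow> lyapunov A (x0, P ** gs x0) \<le> W"
    using lyapunov_initial_bound[OF assms params(1)] by auto
  define B where "B = 2 / A + 8 * L / \<mu>\<^sup>2"
  have B: "0 \<le> B" using params(1) pos by (simp add: B_def)
  define C where "C = sqrt (B * W) + 1"
  have "0 < C" using B \<open>0 \<le> W\<close> by (simp add: C_def add_nonneg_pos)
  show ?thesis
  proof (rule exI[of _ \<epsilon>bar], intro conjI allI impI params(2))
    fix \<epsilon> assume "0 < \<epsilon> \<and> \<epsilon> \<le> \<epsilon>bar"
    then have \<epsilon>: "0 < \<epsilon>" "\<epsilon> \<le> \<epsilon>bar" by auto
    define \<gamma> where "\<gamma> = sqrt (1 - \<kappa> * \<epsilon>)"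
    have \<gamma>: "0 < \<gamma>" "\<gamma> < 1" "\<gamma>\<^sup>2 = 1 - \<kappa> * \<epsilon>"
      using params(3) params(4)[OF \<epsilon>(2)] \<epsilon>(1) by (simp_all add: \<gamma>_def)
    have "norm (fst (iterates \<epsilon> x0 k) $ i - xstar) \<le> C * \<gamma> ^ k"
      if x0: "\<forall>i. norm (x0 $ i - xstar) \<le> r" for x0 k i
    proof -
      have "(norm (fst (iterates \<epsilon> x0 k) $ i - xstar))\<^sup>2 \<le> B * lyapunov A (iterates \<epsilon> x0 k)"
        using squared_error_le_lyapunov[OF params(1), of "fst (iterates \<epsilon> x0 k)" i "snd (iterates \<epsilon> x0 k)"]
        by (simp add: B_def)
      also have "\<dots> \<le> B * ((\<gamma>\<^sup>2) ^ k * lyapunov A (x0, P ** gs x0))"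
        unfolding \<gamma>(3) using B by (intro mult_left_mono decay \<epsilon>)
      also have "\<dots> \<le> B * ((\<gamma>\<^sup>2) ^ k * W)"
        using B by (intro mult_left_mono W x0) auto
      also have "\<dots> = (sqrt (B * W) * \<gamma> ^ k)\<^sup>2"
      proof -
        have "(\<gamma>\<^sup>2) ^ k = (\<gamma> ^ k)\<^sup>2"
          by (simp only: power_mult[symmetric] mult.commute)
        then show ?thesis
          using B \<open>0 \<le> W\<close> by (simp add: power_mult_distrib)
      qed
      finally have "norm (fst (iterates \<epsilon> x0 k) $ i - xstar) \<le> sqrt (B * W) * \<gamma> ^ k"
        by (rule power2_le_imp_le) (use B \<open>0 \<le> W\<close> \<gamma>(1) in simp)
      also have "\<dots> \<le> C * \<gamma> ^ k"
        using \<gamma>(1) by (intro mult_right_mono) (auto simp: C_def)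
      finally show ?thesis .
    qed
    then show "\<exists>C \<gamma>. C > 0 \<and> 0 < \<gamma> \<and> \<gamma> < 1 \<and>
              (\<forall>x0. (\<forall>i. norm (x0 $ i - xstar) \<le> r) \<longrightarrow>
                 (\<forall>k i. norm (fst (iterates \<epsilon> x0 k) $ i - xstar) \<le> C * \<gamma> ^ k))"
      using \<open>0 < C\<close> \<gamma>(1,2) by - (rule exI[of _ C], rule exI[of _ \<gamma>], simp)
  qed
qed

end

section \<open>Network-GIANT\<close>

text \<open>The second equation says that the tracker component at step \<open>k\<close> is the value that the algorithm
  computes for \<open>w\<^sup>k\<^sup>+\<^sup>1\<close> from its state after \<open>k\<close> steps.\<close>

lemma (in network_newton) giant_state_eq_iterates:
  assumes "\<And>i. g i = gradient (f i)" and "\<And>i x. D i x = matrix_inv (hessian (f i) x)"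
  shows "fst (giant_state f P \<epsilon> x0 k) = ($) (fst (iterates \<epsilon> (vec_lambda x0) k))"
    and "(let (x, w, h) = giant_state f P \<epsilon> x0 k
          in (\<lambda>i. \<Sum>j\<in>UNIV. P $ i $ j *\<^sub>R (w j + gradient (f j) (x j) - h j)))
      = ($) (snd (iterates \<epsilon> (vec_lambda x0) k))"
proof (induction k)
  case 0
  show "fst (giant_state f P \<epsilon> x0 0) = ($) (fst (iterates \<epsilon> (vec_lambda x0) 0))"
    and "(let (x, w, h) = giant_state f P \<epsilon> x0 0
          in (\<lambda>i. \<Sum>j\<in>UNIV. P $ i $ j *\<^sub>R (w j + gradient (f j) (x j) - h j)))
      = ($) (snd (iterates \<epsilon> (vec_lambda x0) 0))"
    by (simp_all add: fun_eq_iff matrix_mult_nth gs_def assms)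
next
  case (Suc k)
  obtain x w h where st: "giant_state f P \<epsilon> x0 k = (x, w, h)"
    by (metis prod_cases3)
  obtain X Y where it: "iterates \<epsilon> (vec_lambda x0) k = (X, Y)"
    by fastforce
  have x: "x j = X $ j" for j
    using Suc(1) by (simp add: st it)
  have y: "(\<Sum>j\<in>UNIV. P $ i $ j *\<^sub>R (w j + gradient (f j) (x j) - h j)) = Y $ i" for i
    using fun_cong[OF Suc(2), of i] by (simp add: st it)
  define X' where "X' = step_x \<epsilon> X Y"
  have X': "(\<Sum>j\<in>UNIV. P $ i $ j *\<^sub>R (x j - \<epsilon> *\<^sub>R (matrix_inv (hessian (f j) (x j)) *v Y $ j))) = X' $ i" for i
    by (simp add: X'_def step_x_def matrix_mult_nth Ds_def assms(2) x)
  have st': "giant_state f P \<epsilon> x0 (Suc k) = (($) X', ($) Y, \<lambda>i. gradient (f i) (x i))"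
    by (simp only: giant_state.simps st Let_def prod.case y X')
  have it': "iterates \<epsilon> (vec_lambda x0) (Suc k) = (X', step_y X X' Y)"
    by (simp only: iterates.simps it Let_def prod.case X'_def)
  show "fst (giant_state f P \<epsilon> x0 (Suc k)) = ($) (fst (iterates \<epsilon> (vec_lambda x0) (Suc k)))"
    by (simp only: st' it' fst_conv)
  show "(let (x, w, h) = giant_state f P \<epsilon> x0 (Suc k)
          in (\<lambda>i. \<Sum>j\<in>UNIV. P $ i $ j *\<^sub>R (w j + gradient (f j) (x j) - h j)))
      = ($) (snd (iterates \<epsilon> (vec_lambda x0) (Suc k)))"
    by (rule ext) (simp only: st' it' snd_conv Let_def prod.case step_y_def matrix_mult_nth
        gs_def vector_add_component vector_minus_component vec_lambda_beta assms(1) x)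
qed

theorem theorem2:
  fixes f :: "'n::finite \<Rightarrow> real^'d \<Rightarrow> real"
    and P :: "real^'n^'n"
    and E :: "('n \<times> 'n) set"
    and \<mu> L :: real
    and xstar :: "real^'d"
  assumes differentiable: "\<And>i x. f i differentiable at x"
    and C1_gradient: "\<And>i. continuously_differentiable (gradient (f i))"
    and "\<mu> > 0" and "L > 0"
    and hessian_bounds: "\<And>i x. mat \<mu> \<preceq>\<^sub>L hessian (f i) x \<and> hessian (f i) x \<preceq>\<^sub>L mat L"
    and C1_inverse_hessian: "\<And>i. continuously_differentiable (\<lambda>x. matrix_inv (hessian (f i) x))"
    and minimizer: "is_arg_min (\<lambda>x. (1 / real CARD('n)) * (\<Sum>i\<in>UNIV. f i x)) (\<lambda>_. True) xstar"
    and graph: "connected_graph E"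
    and consensus: "consensus_matrix E P"
    and minus_one_no_eigenvalue: "\<And>v. P *v v = - v \<Longrightarrow> v = 0"
  shows "\<forall>r>0. \<exists>\<epsilon>bar>0. \<forall>\<epsilon>. 0 < \<epsilon> \<and> \<epsilon> \<le> \<epsilon>bar \<longrightarrow>
           (\<exists>C \<gamma>. C > 0 \<and> 0 < \<gamma> \<and> \<gamma> < 1 \<and>
              (\<forall>x0. (\<forall>i. norm (x0 i - xstar) \<le> r) \<longrightarrow>
                 (\<forall>k i. norm (network_giant f P \<epsilon> x0 k i - xstar) \<le> C * \<gamma> ^ k)))"
proof -
  obtain \<sigma> where \<sigma>: "0 \<le> \<sigma>" "\<sigma> < 1" "\<And>z. 1 \<bullet> z = 0 \<Longrightarrow> norm (P *v z) \<le> \<sigma> * norm z"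
    using consensus_matrix_contraction[OF consensus minus_one_no_eigenvalue] by auto
  note bounds = gradient_bounds[OF C1_gradient \<open>\<mu> > 0\<close> \<open>L > 0\<close> hessian_bounds]
  have coercive: "\<mu> * (norm v)\<^sup>2 \<le> v \<bullet> (hessian (f i) x *v v)" for i x v
    using hessian_bounds by (simp add: loewner_le_mat_iff)
  interpret network_newton f "\<lambda>i. gradient (f i)" "\<lambda>i x. matrix_inv (hessian (f i) x)" P \<sigma> \<mu> L
    "\<mu> / L\<^sup>2" xstar
  proof
    show "GDERIV (f i) x :> gradient (f i) x" for i x
      by (rule gderiv_gradient[OF differentiable])
    show "norm (P ** dev z) \<le> \<sigma> * norm (dev z)" for z :: "real^'d^'n"
    proof (rule norm_matrix_mult_le_of_columns[OF \<sigma>(1) \<sigma>(3)])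
      fix j
      have "(\<Sum>i\<in>UNIV. dev z $ i) $ j = 0"
        by (simp only: sum_dev zero_index)
      then show "1 \<bullet> column j (dev z) = 0"
        by (simp add: inner_vec_def column_def)
    qed
    show "norm (P ** z) \<le> norm z" for z :: "real^'d^'n"
      using norm_matrix_mult_le_of_columns[of 1 P z] norm_consensus_matrix_mult_le[OF consensus] by simp
    show "(\<Sum>i\<in>UNIV. f i xstar) \<le> (\<Sum>i\<in>UNIV. f i x)" for x
      using minimizer by (auto simp: is_arg_min_linorder divide_le_cancel)
    show "norm (matrix_inv (hessian (f i) x) *v v) \<le> norm v / \<mu>"
      "\<mu> / L\<^sup>2 * (norm v)\<^sup>2 \<le> v \<bullet> (matrix_inv (hessian (f i) x) *v v)" for i x v
      by (rule matrix_inv_bounds[OF \<open>\<mu> > 0\<close> \<open>L > 0\<close> coercive bounds(1)])+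
  qed (use \<open>\<mu> > 0\<close> \<open>L > 0\<close> in \<open>simp_all add: \<sigma>(1,2) bounds(2,3) consensus_matrix_sums(1,2)[OF consensus]\<close>)
  have eq: "network_giant f P \<epsilon> x0 k = ($) (fst (iterates \<epsilon> (vec_lambda x0) k))" for \<epsilon> x0 k
    unfolding network_giant_def by (rule giant_state_eq_iterates(1)) auto
  show ?thesis
  proof (intro allI impI)
    fix r :: real assume "r > 0"
    show "\<exists>\<epsilon>bar>0. \<forall>\<epsilon>. 0 < \<epsilon> \<and> \<epsilon> \<le> \<epsilon>bar \<longrightarrow>
           (\<exists>C \<gamma>. C > 0 \<and> 0 < \<gamma> \<and> \<gamma> < 1 \<and>
              (\<forall>x0. (\<forall>i. norm (x0 i - xstar) \<le> r) \<longrightarrow>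
                 (\<forall>k i. norm (network_giant f P \<epsilon> x0 k i - xstar) \<le> C * \<gamma> ^ k)))"
    proof -
      obtain \<epsilon>bar where "\<epsilon>bar > 0" and conv: "\<forall>\<epsilon>. 0 < \<epsilon> \<and> \<epsilon> \<le> \<epsilon>bar \<longrightarrow>
           (\<exists>C \<gamma>. C > 0 \<and> 0 < \<gamma> \<and> \<gamma> < 1 \<and>
              (\<forall>x0. (\<forall>i. norm (x0 $ i - xstar) \<le> r) \<longrightarrow>
                 (\<forall>k i. norm (fst (iterates \<epsilon> x0 k) $ i - xstar) \<le> C * \<gamma> ^ k)))"
        using iterates_exponential_convergence[OF less_imp_le[OF \<open>r > 0\<close>]] by (elim exE conjE)
      show ?thesis
      proof (rule exI[of _ \<epsilon>bar], intro conjI allI impI \<open>\<epsilon>bar > 0\<close>)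
        fix \<epsilon> assume "0 < \<epsilon> \<and> \<epsilon> \<le> \<epsilon>bar"
        from conv[rule_format, OF this] obtain C \<gamma> where "C > 0" "0 < \<gamma>" "\<gamma> < 1"
          and bound: "\<forall>x0. (\<forall>i. norm (x0 $ i - xstar) \<le> r) \<longrightarrow>
                 (\<forall>k i. norm (fst (iterates \<epsilon> x0 k) $ i - xstar) \<le> C * \<gamma> ^ k)"
          by (elim exE conjE)
        have bound': "norm (network_giant f P \<epsilon> x0 k i - xstar) \<le> C * \<gamma> ^ k"
          if "\<forall>i. norm (x0 i - xstar) \<le> r" for x0 k i
          using bound[rule_format, of "vec_lambda x0" k i] that by (simp add: eq)
        show "\<exists>C \<gamma>. C > 0 \<and> 0 < \<gamma> \<and> \<gamma> < 1 \<and>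
              (\<forall>x0. (\<forall>i. norm (x0 i - xstar) \<le> r) \<longrightarrow>
                 (\<forall>k i. norm (network_giant f P \<epsilon> x0 k i - xstar) \<le> C * \<gamma> ^ k))"
          using \<open>C > 0\<close> \<open>0 < \<gamma>\<close> \<open>\<gamma> < 1\<close> bound'
          by - (rule exI[of _ C], rule exI[of _ \<gamma>], simp)
      qed
    qed
  qed
qed

end
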